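(* There is a polynomial-time algorithm that, given an instance $\mathcal{I}=((X,d),(\omega,m),(k_1,\dots,k_t),(r_1,\dots,r_t))$ of Robust $t$-NU$k$C (with $t\ge 2$ and $n=|X|$), outputs a collection of $O(n)$ instances of Colorful $(t-1)$-NU$k$C, each of the form $\mathcal{I}(\ell)=((X,d),(\omega_r,\omega_b,m_r,m_b),(k_1,\dots,k_{t-1}),(r'_1,\dots,r'_{t-1}))$ with $r'_i=r_i+3r_t$, with the following properties: (a) if $\mathcal{I}$ is feasible, then at least one of the instances $\mathcal{I}(\ell)$ is feasible; (b) given an $\alpha$-approximate solution to some instance $\mathcal{I}(\ell)$, one can efficiently construct a solution to $\mathcal{I}$ that uses, for each $1\le i\le t$, at most $k_i$ balls of radius at most $\alpha r_i+(3\alpha+3)r_t$, and covers points of total $\omega$-weight at least $m$.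
   Context: Let $(X,d)$ be a finite metric space. For $p\in X$, $r\ge 0$, $B(p,r)=\{q\in X:d(p,q)\le r\}$; balls are centered at points of $X$. For a function $f$ on $X$ and $S\subseteq X$, $f(S)=\sum_{s\in S}f(s)$. An instance of Robust $t$-NU$k$C is $((X,d),(\omega,m),(k_1,\dots,k_t),(r_1,\dots,r_t))$ with $r_1\ge\dots\ge r_t\ge0$, non-negative integers $k_i$, a weight function $\omega:X\to\mathbb{Z}_{\ge 0}$ and an integer $1\le m\le\omega(X)$; a feasible solution is $(\mathcal{B}_1,\dots,\mathcal{B}_t)$ where $\mathcal{B}_i$ is a set of at most $k_i$ balls of radius $r_i$, such that the set of points covered by $\bigcup_i\mathcal{B}_i$ has total $\omega$-weight at least $m$; the instance is feasible if such a solution exists. An instance of Colorful $s$-NU$k$C is $((X,d),(\omega_r,\omega_b,m_r,m_b),(k_1,\dots,k_s),(r_1,\dots,r_s))$ with two weight functions $\omega_r,\omega_b:X\to\mathbb{Z}_{\ge0}$; a feasible solution is $(\mathcal{B}_1,\dots,\mathcal{B}_s)$ with $\mathcal{B}_i$ at most $k_i$ balls of radius $r_i$ such that the covered set $Y$ satisfies $\omega_r(Y)\ge m_r$ and $\omega_b(Y)\ge m_b$. An $\alpha$-approximate solution to an instance is defined the same way but with balls in $\mathcal{B}_i$ of radius $\alpha r_i$. *)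

theory Defs
  imports "HOL-Analysis.Analysis" "HOL-Computational_Algebra.Polynomial"
begin

section \<open>Robust and Colorful non-uniform k-center\<close>

text \<open>Lists are indexed from 0: \<open>budgets ! i\<close> and \<open>radii ! i\<close> are
  $k_{i+1}$ and $r_{i+1}$.\<close>

record 'a nukc =
  points :: "'a set"
  metric_fn :: "'a \<Rightarrow> 'a \<Rightarrow> real"
  budgets :: "nat list"
  radii :: "real list"

record 'a robust_nukc = "'a nukc" +
  weight :: "'a \<Rightarrow> nat"
  demand :: nat

record 'a colorful_nukc = "'a nukc" +
  red :: "'a \<Rightarrow> nat"
  blue :: "'a \<Rightarrow> nat"
  red_demand :: nat
  blue_demand :: nat

definition nukc_frame :: "nat \<Rightarrow> ('a, 'z) nukc_scheme \<Rightarrow> bool" where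
  "nukc_frame t I \<longleftrightarrow>
     Metric_space (points I) (metric_fn I) \<and> finite (points I) \<and>
     length (budgets I) = t \<and> length (radii I) = t \<and>
     sorted_wrt (\<ge>) (radii I) \<and> (\<forall>r\<in>set (radii I). 0 \<le> r)"

definition robust_instance :: "nat \<Rightarrow> 'a robust_nukc \<Rightarrow> bool" where
  "robust_instance t I \<longleftrightarrow>
     nukc_frame t I \<and> 1 \<le> demand I \<and> demand I \<le> sum (weight I) (points I)"

definition colorful_instance :: "nat \<Rightarrow> 'a colorful_nukc \<Rightarrow> bool" where
  "colorful_instance s J \<longleftrightarrow> nukc_frame s J"

text \<open>A ball is a pair (center, radius); a candidate solution is a list of sets of balls.\<close>

definition covered :: "('a, 'z) nukc_scheme \<Rightarrow> ('a \<times> real) set list \<Rightarrow> 'a set" where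
  "covered I \<B> =
     (\<Union>(p, \<rho>) \<in> \<Union>(set \<B>). Metric_space.mcball (points I) (metric_fn I) p \<rho>)"

definition within_budgets :: "('a, 'z) nukc_scheme \<Rightarrow> ('a \<times> real) set list \<Rightarrow> bool" where
  "within_budgets I \<B> \<longleftrightarrow>
     length \<B> = length (budgets I) \<and>
     (\<forall>i<length \<B>. finite (\<B> ! i) \<and> card (\<B> ! i) \<le> budgets I ! i \<and>
        (\<forall>(p, \<rho>)\<in>\<B> ! i. p \<in> points I))"

definition scaled_radii :: "real \<Rightarrow> ('a, 'z) nukc_scheme \<Rightarrow> ('a \<times> real) set list \<Rightarrow> bool" where
  "scaled_radii \<alpha> I \<B> \<longleftrightarrow>
     (\<forall>i<length \<B>. \<forall>(p, \<rho>)\<in>\<B> ! i. \<rho> = \<alpha> * radii I ! i)"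

definition robust_covers :: "'a robust_nukc \<Rightarrow> ('a \<times> real) set list \<Rightarrow> bool" where
  "robust_covers I \<B> \<longleftrightarrow> demand I \<le> sum (weight I) (covered I \<B>)"

definition colorful_covers :: "'a colorful_nukc \<Rightarrow> ('a \<times> real) set list \<Rightarrow> bool" where
  "colorful_covers J \<B> \<longleftrightarrow>
     red_demand J \<le> sum (red J) (covered J \<B>) \<and>
     blue_demand J \<le> sum (blue J) (covered J \<B>)"

definition robust_approx_solution ::
    "real \<Rightarrow> 'a robust_nukc \<Rightarrow> ('a \<times> real) set list \<Rightarrow> bool" where
  "robust_approx_solution \<alpha> I \<B> \<longleftrightarrow>
     within_budgets I \<B> \<and> scaled_radii \<alpha> I \<B> \<and> robust_covers I \<B>"

definition colorful_approx_solution ::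
    "real \<Rightarrow> 'a colorful_nukc \<Rightarrow> ('a \<times> real) set list \<Rightarrow> bool" where
  "colorful_approx_solution \<alpha> J \<B> \<longleftrightarrow>
     within_budgets J \<B> \<and> scaled_radii \<alpha> J \<B> \<and> colorful_covers J \<B>"

definition robust_feasible :: "'a robust_nukc \<Rightarrow> bool" where
  "robust_feasible I \<longleftrightarrow> (\<exists>\<B>. robust_approx_solution 1 I \<B>)"

definition colorful_feasible :: "'a colorful_nukc \<Rightarrow> bool" where
  "colorful_feasible J \<longleftrightarrow> (\<exists>\<B>. colorful_approx_solution 1 J \<B>)"


section \<open>Polynomial time\<close>

text \<open>Distances and radii are arbitrary reals, so algorithms are programs over real numbers with
  unit-cost arithmetic. A program is a finite list of mutually recursive first-order functions
  over numbers and immutable linked lists; function \<open>0\<close> is the entry point. The only numeric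
  operations are addition, subtraction and comparison, and the only constants are 0 and 1. In
  particular a run of length \<open>T\<close> on rational inputs only produces numbers whose bit length exceeds
  that of the whole input by at most \<open>O(T)\<close>, so that polynomially many steps here are polynomially many
  bit operations, and no power is gained from the exact real arithmetic.\<close>

datatype val = Num real | Lst "val list"

datatype expr =
    Var nat
  | Zero
  | One
  | Plus expr expr
  | Minus expr expr
  | Empty
  | Push expr expr
  | Head expr
  | Tail expr
  | IfLe expr expr expr expr
  | IfEmpty expr expr expr
  | LetIn expr expr
  | Call nat "expr list"

type_synonym program = "expr list"

text \<open>\<open>eval P env e v T\<close>: in environment \<open>env\<close> (de Bruijn indices; at a call, the list of
  arguments), \<open>e\<close> evaluates to \<open>v\<close> in \<open>T\<close> steps.\<close>

inductive eval :: "program \<Rightarrow> val list \<Rightarrow> expr \<Rightarrow> val \<Rightarrow> nat \<Rightarrow> bool"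
  and evals :: "program \<Rightarrow> val list \<Rightarrow> expr list \<Rightarrow> val list \<Rightarrow> nat \<Rightarrow> bool"
  for P :: program
where
  eval_Var: "i < length env \<Longrightarrow> eval P env (Var i) (env ! i) 1"
| eval_Zero: "eval P env Zero (Num 0) 1"
| eval_One: "eval P env One (Num 1) 1"
| eval_Plus: "eval P env a (Num x) T \<Longrightarrow> eval P env b (Num y) U \<Longrightarrow>
    eval P env (Plus a b) (Num (x + y)) (T + U + 1)"
| eval_Minus: "eval P env a (Num x) T \<Longrightarrow> eval P env b (Num y) U \<Longrightarrow>
    eval P env (Minus a b) (Num (x - y)) (T + U + 1)"
| eval_Empty: "eval P env Empty (Lst []) 1"
| eval_Push: "eval P env a v T \<Longrightarrow> eval P env b (Lst vs) U \<Longrightarrow>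
    eval P env (Push a b) (Lst (v # vs)) (T + U + 1)"
| eval_Head: "eval P env a (Lst (v # vs)) T \<Longrightarrow> eval P env (Head a) v (T + 1)"
| eval_Tail: "eval P env a (Lst (v # vs)) T \<Longrightarrow> eval P env (Tail a) (Lst vs) (T + 1)"
| eval_IfLe_True: "eval P env a (Num x) T \<Longrightarrow> eval P env b (Num y) U \<Longrightarrow> x \<le> y \<Longrightarrow>
    eval P env c v V \<Longrightarrow> eval P env (IfLe a b c d) v (T + U + V + 1)"
| eval_IfLe_False: "eval P env a (Num x) T \<Longrightarrow> eval P env b (Num y) U \<Longrightarrow> \<not> x \<le> y \<Longrightarrow>
    eval P env d v V \<Longrightarrow> eval P env (IfLe a b c d) v (T + U + V + 1)"
| eval_IfEmpty_True: "eval P env a (Lst []) T \<Longrightarrow> eval P env b v U \<Longrightarrow>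
    eval P env (IfEmpty a b c) v (T + U + 1)"
| eval_IfEmpty_False: "eval P env a (Lst (w # ws)) T \<Longrightarrow> eval P env c v U \<Longrightarrow>
    eval P env (IfEmpty a b c) v (T + U + 1)"
| eval_LetIn: "eval P env a w T \<Longrightarrow> eval P (w # env) b v U \<Longrightarrow>
    eval P env (LetIn a b) v (T + U + 1)"
| eval_Call: "f < length P \<Longrightarrow> evals P env as ws T \<Longrightarrow> eval P ws (P ! f) v U \<Longrightarrow>
    eval P env (Call f as) v (T + U + 1)"
| evals_Nil: "evals P env [] [] 0"
| evals_Cons: "eval P env a w T \<Longrightarrow> evals P env as ws U \<Longrightarrow>
    evals P env (a # as) (w # ws) (T + U)"

inductive_cases eval_elims:
  "eval P env (Var i) v T"
  "eval P env Zero v T"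
  "eval P env One v T"
  "eval P env (Plus a b) v T"
  "eval P env (Minus a b) v T"
  "eval P env Empty v T"
  "eval P env (Push a b) v T"
  "eval P env (Head a) v T"
  "eval P env (Tail a) v T"
  "eval P env (IfLe a b c d) v T"
  "eval P env (IfEmpty a b c) v T"
  "eval P env (LetIn a b) v T"
  "eval P env (Call f as) v T"
  "evals P env [] vs T"
  "evals P env (a # as) vs T"

lemma eval_deterministic:
  "eval P env e v T \<Longrightarrow> eval P env e v' T' \<Longrightarrow> v' = v \<and> T' = T"
  "evals P env es vs T \<Longrightarrow> evals P env es vs' T' \<Longrightarrow> vs' = vs \<and> T' = T"
proof (induction arbitrary: v' T' and vs' T' rule: eval_evals.inducts)
  case (eval_Var i env)
  then show ?case by (auto elim: eval_elims)
next
  case (eval_Zero env)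
  then show ?case by (auto elim: eval_elims)
next
  case (eval_One env)
  then show ?case by (auto elim: eval_elims)
next
  case (eval_Empty env)
  then show ?case by (auto elim: eval_elims)
next
  case (eval_Plus env a x T b y U v' T')
  from eval_Plus.prems obtain x' T1 y' U1 where eq: "v' = Num (x' + y')" "T' = T1 + U1 + 1"
    and 1: "eval P env a (Num x') T1" and 2: "eval P env b (Num y') U1"
    by (elim eval_elims) auto
  show ?case using eq eval_Plus.IH(2)[OF 1] eval_Plus.IH(4)[OF 2] by simp
next
  case (eval_Minus env a x T b y U v' T')
  from eval_Minus.prems obtain x' T1 y' U1 where eq: "v' = Num (x' - y')" "T' = T1 + U1 + 1"
    and 1: "eval P env a (Num x') T1" and 2: "eval P env b (Num y') U1"
    by (elim eval_elims) auto
  show ?case using eq eval_Minus.IH(2)[OF 1] eval_Minus.IH(4)[OF 2] by simp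
next
  case (eval_Push env a v T b vs U v' T')
  from eval_Push.prems obtain w T1 ws U1 where eq: "v' = Lst (w # ws)" "T' = T1 + U1 + 1"
    and 1: "eval P env a w T1" and 2: "eval P env b (Lst ws) U1"
    by (elim eval_elims) auto
  show ?case using eq eval_Push.IH(2)[OF 1] eval_Push.IH(4)[OF 2] by simp
next
  case (eval_Head env a v vs T v' T')
  from eval_Head.prems obtain w ws T1 where eq: "v' = w" "T' = T1 + 1"
    and 1: "eval P env a (Lst (w # ws)) T1"
    by (elim eval_elims) auto
  show ?case using eq eval_Head.IH(2)[OF 1] by simp
next
  case (eval_Tail env a v vs T v' T')
  from eval_Tail.prems obtain w ws T1 where eq: "v' = Lst ws" "T' = T1 + 1"
    and 1: "eval P env a (Lst (w # ws)) T1"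
    by (elim eval_elims) auto
  show ?case using eq eval_Tail.IH(2)[OF 1] by simp
next
  case (eval_IfLe_True env a x T b y U c v V d v' T')
  from eval_IfLe_True.prems obtain x' T1 y' U1 V1 where eq: "T' = T1 + U1 + V1 + 1"
    and 1: "eval P env a (Num x') T1" and 2: "eval P env b (Num y') U1"
    and 3: "x' \<le> y' \<and> eval P env c v' V1 \<or> \<not> x' \<le> y' \<and> eval P env d v' V1"
    by (elim eval_elims) auto
  have "eval P env c v' V1"
    using 3 eval_IfLe_True.IH(2)[OF 1] eval_IfLe_True.IH(4)[OF 2] eval_IfLe_True.hyps by simp
  from eval_IfLe_True.IH(6)[OF this] show ?case
    using eq eval_IfLe_True.IH(2)[OF 1] eval_IfLe_True.IH(4)[OF 2] by simp
next
  case (eval_IfLe_False env a x T b y U d v V c v' T')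
  from eval_IfLe_False.prems obtain x' T1 y' U1 V1 where eq: "T' = T1 + U1 + V1 + 1"
    and 1: "eval P env a (Num x') T1" and 2: "eval P env b (Num y') U1"
    and 3: "x' \<le> y' \<and> eval P env c v' V1 \<or> \<not> x' \<le> y' \<and> eval P env d v' V1"
    by (elim eval_elims) auto
  have "eval P env d v' V1"
    using 3 eval_IfLe_False.IH(2)[OF 1] eval_IfLe_False.IH(4)[OF 2] eval_IfLe_False.hyps by simp
  from eval_IfLe_False.IH(6)[OF this] show ?case
    using eq eval_IfLe_False.IH(2)[OF 1] eval_IfLe_False.IH(4)[OF 2] by simp
next
  case (eval_IfEmpty_True env a T b v U c v' T')
  from eval_IfEmpty_True.prems obtain us T1 U1 where eq: "T' = T1 + U1 + 1"
    and 1: "eval P env a (Lst us) T1"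
    and 2: "us = [] \<and> eval P env b v' U1 \<or> us \<noteq> [] \<and> eval P env c v' U1"
    by (elim eval_elims) auto
  have "eval P env b v' U1" using 2 eval_IfEmpty_True.IH(2)[OF 1] by simp
  from eval_IfEmpty_True.IH(4)[OF this] show ?case using eq eval_IfEmpty_True.IH(2)[OF 1] by simp
next
  case (eval_IfEmpty_False env a w ws T c v U b v' T')
  from eval_IfEmpty_False.prems obtain us T1 U1 where eq: "T' = T1 + U1 + 1"
    and 1: "eval P env a (Lst us) T1"
    and 2: "us = [] \<and> eval P env b v' U1 \<or> us \<noteq> [] \<and> eval P env c v' U1"
    by (elim eval_elims) auto
  have "eval P env c v' U1" using 2 eval_IfEmpty_False.IH(2)[OF 1] by simp
  from eval_IfEmpty_False.IH(4)[OF this] show ?case using eq eval_IfEmpty_False.IH(2)[OF 1] by simp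
next
  case (eval_LetIn env a w T b v U v' T')
  from eval_LetIn.prems obtain w' T1 U1 where eq: "T' = T1 + U1 + 1"
    and 1: "eval P env a w' T1" and 2: "eval P (w' # env) b v' U1"
    by (elim eval_elims) auto
  from 2 eval_LetIn.IH(2)[OF 1] have "eval P (w # env) b v' U1" by simp
  from eval_LetIn.IH(4)[OF this] show ?case using eq eval_LetIn.IH(2)[OF 1] by simp
next
  case (eval_Call f env as ws T v U v' T')
  from eval_Call.prems obtain ws' T1 U1 where eq: "T' = T1 + U1 + 1"
    and 1: "evals P env as ws' T1" and 2: "eval P ws' (P ! f) v' U1"
    by (elim eval_elims) auto
  from 2 eval_Call.IH(3)[OF 1] have "eval P ws (P ! f) v' U1" by simp
  from eval_Call.IH(5)[OF this] show ?case using eq eval_Call.IH(3)[OF 1] by simp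
next
  case (evals_Nil env)
  then show ?case by (auto elim: eval_elims)
next
  case (evals_Cons env a w T as ws U vs' T')
  from evals_Cons.prems obtain w' T1 ws' U1 where eq: "vs' = w' # ws'" "T' = T1 + U1"
    and 1: "eval P env a w' T1" and 2: "evals P env as ws' U1"
    by (elim eval_elims) auto
  show ?case using eq evals_Cons.IH(2)[OF 1] evals_Cons.IH(4)[OF 2] by simp
qed

fun val_size :: "val \<Rightarrow> nat" where
  "val_size (Num x) = 1"
| "val_size (Lst vs) = 1 + sum_list (map val_size vs)"

definition poly_time_computable ::
    "'i set \<Rightarrow> ('i \<Rightarrow> val) \<Rightarrow> ('o \<Rightarrow> val) \<Rightarrow> ('i \<Rightarrow> 'o) \<Rightarrow> bool" where
  "poly_time_computable D enc_in enc_out F \<longleftrightarrow>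
     (\<exists>P :: program. \<exists>q :: nat poly. \<forall>x\<in>D. \<exists>T.
        eval P [enc_in x] (Call 0 [Var 0]) (enc_out (F x)) T \<and>
        T \<le> poly q (val_size (enc_in x)))"


section \<open>Encodings\<close>

text \<open>As input to an algorithm, the \<open>n\<close> points are numbered \<open>0, \<dots>, n - 1\<close>, the metric is
  given by its distance matrix and weight functions by their lists of values.\<close>

definition numbered :: "(nat, 'z) nukc_scheme \<Rightarrow> bool" where
  "numbered I \<longleftrightarrow> points I = {..<card (points I)}"

definition enc_list :: "('b \<Rightarrow> val) \<Rightarrow> 'b list \<Rightarrow> val" where
  "enc_list enc xs = Lst (map enc xs)"

definition enc_nat :: "nat \<Rightarrow> val" where
  "enc_nat k = Num (real k)"

definition enc_fun :: "nat \<Rightarrow> (nat \<Rightarrow> val) \<Rightarrow> val" where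
  "enc_fun n f = Lst (map f [0..<n])"

definition enc_metric :: "(nat, 'z) nukc_scheme \<Rightarrow> val" where
  "enc_metric I = (let n = card (points I) in
     enc_fun n (\<lambda>i. enc_fun n (\<lambda>j. Num (metric_fn I i j))))"

definition enc_weights :: "(nat, 'z) nukc_scheme \<Rightarrow> (nat \<Rightarrow> nat) \<Rightarrow> val" where
  "enc_weights I w = enc_fun (card (points I)) (\<lambda>i. enc_nat (w i))"

definition enc_robust :: "nat robust_nukc \<Rightarrow> val" where
  "enc_robust I = Lst
     [enc_metric I, enc_weights I (weight I), enc_nat (demand I),
      enc_list enc_nat (budgets I), enc_list Num (radii I)]"

definition enc_colorful :: "nat colorful_nukc \<Rightarrow> val" where
  "enc_colorful J = Lst
     [enc_metric J, enc_weights J (red J), enc_weights J (blue J),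
      enc_nat (red_demand J), enc_nat (blue_demand J),
      enc_list enc_nat (budgets J), enc_list Num (radii J)]"

definition enc_ball :: "nat \<times> real \<Rightarrow> val" where
  "enc_ball b = Lst [enc_nat (fst b), Num (snd b)]"

definition enc_balls :: "(nat \<times> real) list list \<Rightarrow> val" where
  "enc_balls = enc_list (enc_list enc_ball)"

definition enc_triple ::
    "nat robust_nukc \<times> nat colorful_nukc \<times> (nat \<times> real) list list \<Rightarrow> val" where
  "enc_triple = (\<lambda>(I, J, S). Lst [enc_robust I, enc_colorful J, enc_balls S])"

end

theory Submission
  imports Defs
begin

text \<open>
  Write \<open>r\<close> for the smallest radius and \<open>k\<close> for its budget. Starting from \<open>u\<^sub>0 = \<omega>\<close>, repeatedly choose
  a pivot \<open>p\<^sub>i\<close> whose \<open>r\<close>-ball has maximal \<open>u\<^sub>i\<close>-weight and let \<open>u\<^sub>i\<^sub>+\<^sub>1\<close> be \<open>u\<^sub>i\<close> set to zero on the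
  \<open>3r\<close>-ball of \<open>p\<^sub>i\<close>. In the colorful instance \<open>\<I>(i)\<close>, for \<open>0 \<le> i \<le> n\<close>, the red points are the first
  \<open>i\<close> pivots, with demand \<open>i - k\<close>; the blue weight is \<open>u\<^sub>i\<close>, and its demand is \<open>m\<close> minus the weight
  that has been set to zero.

  From a solution of \<open>\<I>(i)\<close>, enlarge all balls by \<open>3r\<close> and add a \<open>3r\<close>-ball at each of the at most
  \<open>k\<close> uncovered pivots: then everything that was set to zero is covered, and so is the blue part.

  Conversely, given a feasible solution, let \<open>L\<close> be the set covered by its balls of the larger radii.
  Call step \<open>i\<close> untouched if \<open>L\<close> contains no point whose weight it sets to zero; the pivots of the
  other steps are covered by the larger balls enlarged by \<open>3r\<close>. At each untouched step one more of
  the \<open>k\<close> small balls is charged: one whose remaining points are all removed, if the \<open>r\<close>-ball of the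
  pivot meets some uncharged small ball, and otherwise any one, whose remaining weight is then at
  most that of the \<open>r\<close>-ball of the pivot. Stopping when every small ball is charged, or after \<open>n\<close>
  steps, gives a feasible \<open>\<I>(i)\<close>.
\<close>

section \<open>Evaluation as a function\<close>

text \<open>\<open>eval\<close> is deterministic, hence a partial function. In this form every
  construct has an equation, and the simplifier can execute programs symbolically.\<close>

definition sem :: "program \<Rightarrow> val list \<Rightarrow> expr \<Rightarrow> (val \<times> nat) option" where
  "sem P env e = (if \<exists>v T. eval P env e v T
     then Some (SOME z. eval P env e (fst z) (snd z)) else None)"

definition sems :: "program \<Rightarrow> val list \<Rightarrow> expr list \<Rightarrow> (val list \<times> nat) option" where
  "sems P env es = (if \<exists>vs T. evals P env es vs T
     then Some (SOME z. evals P env es (fst z) (snd z)) else None)"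

text \<open>\<open>sem_simps\<close> does not unfold this constant, so simplification stops at every
  call, where an earlier result about the callee or the induction hypothesis takes over.\<close>

definition call :: "program \<Rightarrow> nat \<Rightarrow> val list \<Rightarrow> (val \<times> nat) option" where
  "call P f ws = sem P ws (P ! f)"

text \<open>Determinism makes the value chosen by \<open>SOME\<close> the only candidate.\<close>

lemma sem_eq_Some_iff: "sem P env e = Some z \<longleftrightarrow> eval P env e (fst z) (snd z)"
proof (cases "\<exists>y. eval P env e (fst y) (snd y)")
  case True
  then obtain y where y: "eval P env e (fst y) (snd y)" by blast
  have unique: "z = y" if "eval P env e (fst z) (snd z)" for z
    using eval_deterministic(1)[OF y that] by (simp add: prod_eq_iff)
  have "(SOME z. eval P env e (fst z) (snd z)) = y"
  proof (rule some_equality)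
    show "eval P env e (fst y) (snd y)" by (rule y)
    show "z = y" if "eval P env e (fst z) (snd z)" for z by (rule unique[OF that])
  qed
  with y have "sem P env e = Some y" unfolding sem_def by auto
  then have "sem P env e = Some z \<longleftrightarrow> z = y" by auto
  with y unique[of z] show ?thesis by metis
next
  case False
  then show ?thesis unfolding sem_def by (auto simp: split_paired_Ex)
qed

lemma sems_eq_Some_iff: "sems P env es = Some z \<longleftrightarrow> evals P env es (fst z) (snd z)"
proof (cases "\<exists>y. evals P env es (fst y) (snd y)")
  case True
  then obtain y where y: "evals P env es (fst y) (snd y)" by blast
  have unique: "z = y" if "evals P env es (fst z) (snd z)" for z
    using eval_deterministic(2)[OF y that] by (simp add: prod_eq_iff)
  have "(SOME z. evals P env es (fst z) (snd z)) = y"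
  proof (rule some_equality)
    show "evals P env es (fst y) (snd y)" by (rule y)
    show "z = y" if "evals P env es (fst z) (snd z)" for z by (rule unique[OF that])
  qed
  with y have "sems P env es = Some y" unfolding sems_def by auto
  then have "sems P env es = Some z \<longleftrightarrow> z = y" by auto
  with y unique[of z] show ?thesis by metis
next
  case False
  then show ?thesis unfolding sems_def by (auto simp: split_paired_Ex)
qed

lemma option_eqI: "(\<And>z. x = Some z \<longleftrightarrow> y = Some z) \<Longrightarrow> x = y"
  by (cases x; cases y) auto

section \<open>Evaluation equations for each construct\<close>

named_theorems sem_simps

lemma sem_Var [sem_simps]:
  "sem P env (Var i) = (if i < length env then Some (env ! i, 1) else None)"
  by (rule option_eqI) (auto simp: sem_eq_Some_iff elim: eval_elims intro: eval_Var[simplified])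

lemma sem_Zero [sem_simps]: "sem P env Zero = Some (Num 0, 1)"
  by (simp add: sem_eq_Some_iff eval_Zero[simplified])

lemma sem_One [sem_simps]: "sem P env One = Some (Num 1, 1)"
  by (simp add: sem_eq_Some_iff eval_One[simplified])

lemma sem_Empty [sem_simps]: "sem P env Empty = Some (Lst [], 1)"
  by (simp add: sem_eq_Some_iff eval_Empty[simplified])

lemma sem_Plus [sem_simps]:
  "sem P env (Plus a b) =
    (case sem P env a of Some (Num x, T) \<Rightarrow>
      (case sem P env b of Some (Num y, U) \<Rightarrow> Some (Num (x + y), Suc (T + U)) | _ \<Rightarrow> None)
     | _ \<Rightarrow> None)" (is "?l = ?r")
proof (rule option_eqI)
  fix z
  have "?l = Some z \<longleftrightarrow> (\<exists>x T y U. z = (Num (x + y), Suc (T + U)) \<and>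
     eval P env a (Num x) T \<and> eval P env b (Num y) U)"
    unfolding sem_eq_Some_iff
    by (cases z) (auto elim!: eval_elims intro: eval_Plus[simplified])
  also have "\<dots> \<longleftrightarrow> (\<exists>x T y U. z = (Num (x + y), Suc (T + U)) \<and>
     sem P env a = Some ((Num x), T) \<and> sem P env b = Some ((Num y), U))"
    by (simp add: sem_eq_Some_iff sems_eq_Some_iff)
  also have "\<dots> \<longleftrightarrow> ?r = Some z"
    by (auto split: option.splits val.splits list.splits prod.splits)
  finally show "?l = Some z \<longleftrightarrow> ?r = Some z" .
qed

lemma sem_Minus [sem_simps]:
  "sem P env (Minus a b) =
    (case sem P env a of Some (Num x, T) \<Rightarrow>
      (case sem P env b of Some (Num y, U) \<Rightarrow> Some (Num (x - y), Suc (T + U)) | _ \<Rightarrow> None)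
     | _ \<Rightarrow> None)" (is "?l = ?r")
proof (rule option_eqI)
  fix z
  have "?l = Some z \<longleftrightarrow> (\<exists>x T y U. z = (Num (x - y), Suc (T + U)) \<and>
     eval P env a (Num x) T \<and> eval P env b (Num y) U)"
    unfolding sem_eq_Some_iff
    by (cases z) (auto elim!: eval_elims intro: eval_Minus[simplified])
  also have "\<dots> \<longleftrightarrow> (\<exists>x T y U. z = (Num (x - y), Suc (T + U)) \<and>
     sem P env a = Some ((Num x), T) \<and> sem P env b = Some ((Num y), U))"
    by (simp add: sem_eq_Some_iff sems_eq_Some_iff)
  also have "\<dots> \<longleftrightarrow> ?r = Some z"
    by (auto split: option.splits val.splits list.splits prod.splits)
  finally show "?l = Some z \<longleftrightarrow> ?r = Some z" .
qed

lemma sem_Push [sem_simps]: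
  "sem P env (Push a b) =
    (case sem P env a of Some (v, T) \<Rightarrow>
      (case sem P env b of Some (Lst vs, U) \<Rightarrow> Some (Lst (v # vs), Suc (T + U)) | _ \<Rightarrow> None)
     | _ \<Rightarrow> None)" (is "?l = ?r")
proof (rule option_eqI)
  fix z
  have "?l = Some z \<longleftrightarrow> (\<exists>v T vs U. z = (Lst (v # vs), Suc (T + U)) \<and>
     eval P env a v T \<and> eval P env b (Lst vs) U)"
    unfolding sem_eq_Some_iff
    by (cases z) (auto elim!: eval_elims intro: eval_Push[simplified])
  also have "\<dots> \<longleftrightarrow> (\<exists>v T vs U. z = (Lst (v # vs), Suc (T + U)) \<and>
     sem P env a = Some (v, T) \<and> sem P env b = Some ((Lst vs), U))"
    by (simp add: sem_eq_Some_iff sems_eq_Some_iff)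
  also have "\<dots> \<longleftrightarrow> ?r = Some z"
    by (auto split: option.splits val.splits list.splits prod.splits)
  finally show "?l = Some z \<longleftrightarrow> ?r = Some z" .
qed

lemma sem_Head [sem_simps]:
  "sem P env (Head a) =
    (case sem P env a of Some (Lst (v # vs), T) \<Rightarrow> Some (v, Suc T) | _ \<Rightarrow> None)" (is "?l = ?r")
proof (rule option_eqI)
  fix z
  have "?l = Some z \<longleftrightarrow> (\<exists>v vs T. z = (v, Suc T) \<and> eval P env a (Lst (v # vs)) T)"
    unfolding sem_eq_Some_iff
    by (cases z) (auto elim!: eval_elims intro: eval_Head[simplified])
  also have "\<dots> \<longleftrightarrow> (\<exists>v vs T. z = (v, Suc T) \<and> sem P env a = Some ((Lst (v # vs)), T))"
    by (simp add: sem_eq_Some_iff sems_eq_Some_iff)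
  also have "\<dots> \<longleftrightarrow> ?r = Some z"
    by (auto split: option.splits val.splits list.splits prod.splits)
  finally show "?l = Some z \<longleftrightarrow> ?r = Some z" .
qed

lemma sem_Tail [sem_simps]:
  "sem P env (Tail a) =
    (case sem P env a of Some (Lst (v # vs), T) \<Rightarrow> Some (Lst vs, Suc T) | _ \<Rightarrow> None)" (is "?l = ?r")
proof (rule option_eqI)
  fix z
  have "?l = Some z \<longleftrightarrow> (\<exists>v vs T. z = (Lst vs, Suc T) \<and> eval P env a (Lst (v # vs)) T)"
    unfolding sem_eq_Some_iff
    by (cases z) (auto elim!: eval_elims intro: eval_Tail[simplified])
  also have "\<dots> \<longleftrightarrow> (\<exists>v vs T. z = (Lst vs, Suc T) \<and> sem P env a = Some ((Lst (v # vs)), T))"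
    by (simp add: sem_eq_Some_iff sems_eq_Some_iff)
  also have "\<dots> \<longleftrightarrow> ?r = Some z"
    by (auto split: option.splits val.splits list.splits prod.splits)
  finally show "?l = Some z \<longleftrightarrow> ?r = Some z" .
qed

lemma sem_IfLe [sem_simps]:
  "sem P env (IfLe a b c d) =
    (case sem P env a of Some (Num x, T) \<Rightarrow>
      (case sem P env b of Some (Num y, U) \<Rightarrow>
        (case if x \<le> y then sem P env c else sem P env d of
          Some (v, V) \<Rightarrow> Some (v, Suc (T + U + V)) | _ \<Rightarrow> None) | _ \<Rightarrow> None)
     | _ \<Rightarrow> None)" (is "?l = ?r")
proof (rule option_eqI)
  fix z
  have "?l = Some z \<longleftrightarrow> (\<exists>x T y U v V. z = (v, Suc (T + U + V)) \<and>
     eval P env a (Num x) T \<and> eval P env b (Num y) U \<and>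
     (x \<le> y \<and> eval P env c v V \<or> \<not> x \<le> y \<and> eval P env d v V))"
    unfolding sem_eq_Some_iff
    by (cases z) (auto elim!: eval_elims intro: eval_IfLe_True[simplified] eval_IfLe_False[simplified], blast+)
  also have "\<dots> \<longleftrightarrow> (\<exists>x T y U v V. z = (v, Suc (T + U + V)) \<and>
     sem P env a = Some ((Num x), T) \<and> sem P env b = Some ((Num y), U) \<and>
     (x \<le> y \<and> sem P env c = Some (v, V) \<or> \<not> x \<le> y \<and> sem P env d = Some (v, V)))"
    by (simp add: sem_eq_Some_iff sems_eq_Some_iff)
  also have "\<dots> \<longleftrightarrow> ?r = Some z"
    by (cases "sem P env a"; cases "sem P env b"; cases "sem P env c"; cases "sem P env d")
      (auto split: val.splits prod.splits)
  finally show "?l = Some z \<longleftrightarrow> ?r = Some z" .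
qed

lemma sem_IfEmpty [sem_simps]:
  "sem P env (IfEmpty a b c) =
    (case sem P env a of Some (Lst ws, T) \<Rightarrow>
        (case if ws = [] then sem P env b else sem P env c of
          Some (v, U) \<Rightarrow> Some (v, Suc (T + U)) | _ \<Rightarrow> None)
     | _ \<Rightarrow> None)" (is "?l = ?r")
proof (rule option_eqI)
  fix z
  have "?l = Some z \<longleftrightarrow> (\<exists>w ws T v U. z = (v, Suc (T + U)) \<and>
     (eval P env a (Lst []) T \<and> eval P env b v U \<or>
      eval P env a (Lst (w # ws)) T \<and> eval P env c v U))"
    unfolding sem_eq_Some_iff
    by (cases z) (auto elim!: eval_elims intro: eval_IfEmpty_True[simplified] eval_IfEmpty_False[simplified])
  also have "\<dots> \<longleftrightarrow> (\<exists>w ws T v U. z = (v, Suc (T + U)) \<and>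
     (sem P env a = Some ((Lst []), T) \<and> sem P env b = Some (v, U) \<or>
      sem P env a = Some ((Lst (w # ws)), T) \<and> sem P env c = Some (v, U)))"
    by (simp add: sem_eq_Some_iff sems_eq_Some_iff)
  also have "\<dots> \<longleftrightarrow> ?r = Some z"
    by (cases "sem P env a"; cases "sem P env b"; cases "sem P env c")
      (auto simp: neq_Nil_conv split: val.splits prod.splits)
  finally show "?l = Some z \<longleftrightarrow> ?r = Some z" .
qed

lemma sem_LetIn [sem_simps]:
  "sem P env (LetIn a b) =
    (case sem P env a of Some (w, T) \<Rightarrow>
      (case sem P (w # env) b of Some (v, U) \<Rightarrow> Some (v, Suc (T + U)) | _ \<Rightarrow> None)
     | _ \<Rightarrow> None)" (is "?l = ?r")
proof (rule option_eqI)
  fix z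
  have "?l = Some z \<longleftrightarrow> (\<exists>w T v U. z = (v, Suc (T + U)) \<and>
     eval P env a w T \<and> eval P (w # env) b v U)"
    unfolding sem_eq_Some_iff
    by (cases z) (auto elim!: eval_elims intro: eval_LetIn[simplified])
  also have "\<dots> \<longleftrightarrow> (\<exists>w T v U. z = (v, Suc (T + U)) \<and>
     sem P env a = Some (w, T) \<and> sem P (w # env) b = Some (v, U))"
    by (simp add: sem_eq_Some_iff sems_eq_Some_iff)
  also have "\<dots> \<longleftrightarrow> ?r = Some z"
    by (auto split: option.splits val.splits list.splits prod.splits)
  finally show "?l = Some z \<longleftrightarrow> ?r = Some z" .
qed

lemma sem_Call [sem_simps]:
  "sem P env (Call f as) =
    (case sems P env as of Some (ws, T) \<Rightarrow>
      (if f < length P then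
        (case call P f ws of Some (v, U) \<Rightarrow> Some (v, Suc (T + U)) | _ \<Rightarrow> None) else None)
     | _ \<Rightarrow> None)" (is "?l = ?r")
proof (rule option_eqI)
  fix z
  have "?l = Some z \<longleftrightarrow> (\<exists>ws T v U. z = (v, Suc (T + U)) \<and> f < length P \<and>
     evals P env as ws T \<and> eval P ws (P ! f) v U)"
    unfolding sem_eq_Some_iff
    by (cases z) (auto elim!: eval_elims intro: eval_Call[simplified])
  also have "\<dots> \<longleftrightarrow> (\<exists>ws T v U. z = (v, Suc (T + U)) \<and> f < length P \<and>
     sems P env as = Some (ws, T) \<and> sem P ws (P ! f) = Some (v, U))"
    by (simp add: sem_eq_Some_iff sems_eq_Some_iff)
  also have "\<dots> \<longleftrightarrow> ?r = Some z"
    by (auto simp: call_def split: option.splits prod.splits)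
  finally show "?l = Some z \<longleftrightarrow> ?r = Some z" .
qed

lemma sems_Nil [sem_simps]: "sems P env [] = Some ([], 0)"
  by (simp add: sems_eq_Some_iff evals_Nil)

lemma sems_Cons [sem_simps]:
  "sems P env (a # as) =
    (case sem P env a of Some (w, T) \<Rightarrow>
      (case sems P env as of Some (ws, U) \<Rightarrow> Some (w # ws, T + U) | _ \<Rightarrow> None)
     | _ \<Rightarrow> None)" (is "?l = ?r")
proof (rule option_eqI)
  fix z
  have "?l = Some z \<longleftrightarrow> (\<exists>w T ws U. z = (w # ws, T + U) \<and>
     eval P env a w T \<and> evals P env as ws U)"
    unfolding sems_eq_Some_iff
    by (cases z) (auto elim!: eval_elims intro: evals_Cons)
  also have "\<dots> \<longleftrightarrow> (\<exists>w T ws U. z = (w # ws, T + U) \<and>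
     sem P env a = Some (w, T) \<and> sems P env as = Some (ws, U))"
    by (simp add: sem_eq_Some_iff sems_eq_Some_iff)
  also have "\<dots> \<longleftrightarrow> ?r = Some z"
    by (auto split: option.splits val.splits list.splits prod.splits)
  finally show "?l = Some z \<longleftrightarrow> ?r = Some z" .
qed

text \<open>An upper bound instead of the exact time lets the costs of subroutines be rounded up
  before they are added.\<close>

definition runs_in :: "program \<Rightarrow> nat \<Rightarrow> val list \<Rightarrow> val \<Rightarrow> nat \<Rightarrow> bool" where
  "runs_in P f ws v B \<longleftrightarrow> (\<exists>T\<le>B. call P f ws = Some (v, T))"

lemma runs_inE:
  assumes "runs_in P f ws v B"
  obtains T where "call P f ws = Some (v, T)" "T \<le> B"
  using assms unfolding runs_in_def by blast

lemma runs_in_mono: "runs_in P f ws v B \<Longrightarrow> B \<le> C \<Longrightarrow> runs_in P f ws v C"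
  unfolding runs_in_def using order_trans by blast

lemma poly_time_computableI:
  assumes "P \<noteq> []"
    and "\<And>x. x \<in> D \<Longrightarrow>
      runs_in P 0 [enc_in x] (enc_out (F x)) (c * (val_size (enc_in x) + 1) ^ k)"
  shows "poly_time_computable D enc_in enc_out F"
proof -
  \<comment> \<open>Two steps come on top of the run of the body: one for \<open>Var 0\<close> and
    one for the call. Since \<open>(?N + 1) ^ k\<close> is at least 1, adding 2 to \<open>c\<close>
    absorbs them.\<close>
  let ?q = "[:c + 2:] * [:1, 1:] ^ k :: nat poly"
  have "\<exists>T. eval P [enc_in x] (Call 0 [Var 0]) (enc_out (F x)) T \<and>
      T \<le> poly ?q (val_size (enc_in x))" if x: "x \<in> D" for x
  proof -
    let ?N = "val_size (enc_in x)"
    obtain T where T: "call P 0 [enc_in x] = Some (enc_out (F x), T)" "T \<le> c * (?N + 1) ^ k"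
      using assms(2)[OF x] by (rule runs_inE)
    have "sem P [enc_in x] (Call 0 [Var 0]) = Some (enc_out (F x), Suc (1 + T))"
      using assms(1) T(1) by (simp add: sem_simps)
    then have "eval P [enc_in x] (Call 0 [Var 0]) (enc_out (F x)) (Suc (1 + T))"
      by (simp add: sem_eq_Some_iff)
    moreover have "Suc (1 + T) \<le> poly ?q ?N"
    proof -
      have "poly ?q ?N = c * (?N + 1) ^ k + 2 * (?N + 1) ^ k"
        by (simp add: poly_power algebra_simps)
      moreover have "1 \<le> (?N + 1) ^ k" by simp
      ultimately show ?thesis using T(2) by linarith
    qed
    ultimately show ?thesis by blast
  qed
  then show ?thesis unfolding poly_time_computable_def by blast
qed

section \<open>The programs\<close>

text \<open>
  \<open>Call i\<close> refers to entry \<open>i\<close> of \<open>prog\<close> below. The entry point is a parameter, so that both algorithms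
  share their subroutines.
\<close>

definition body_last :: expr where
  "body_last = IfEmpty (Tail (Var 0)) (Head (Var 0)) (Call 1 [Tail (Var 0)])"

text \<open>With summand \<open>3r\<close> this yields the radii of the colorful instances; with
  summand 0 it acts as \<open>butlast\<close> on the budgets.\<close>

definition body_shift :: expr where
  "body_shift = IfEmpty (Tail (Var 0)) Empty
     (Push (Plus (Head (Var 0)) (Var 1)) (Call 2 [Tail (Var 0), Var 1]))"

definition body_zeros :: expr where
  "body_zeros = IfEmpty (Var 0) Empty (Push Zero (Call 3 [Tail (Var 0)]))"

text \<open>The arguments are the row of the center, the weights and the radius.\<close>

definition body_ball :: expr where
  "body_ball = IfEmpty (Var 0) Zero
     (IfLe (Head (Var 0)) (Var 2)
       (Plus (Head (Var 1)) (Call 4 [Tail (Var 0), Tail (Var 1), Var 2]))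
       (Call 4 [Tail (Var 0), Tail (Var 1), Var 2]))"

text \<open>The first argument holds the rows of the candidates still to be tried, the last one the
  row of the best center so far.\<close>

definition body_best :: expr where
  "body_best = IfEmpty (Var 0) (Var 3)
     (IfLe (Call 4 [Var 3, Var 1, Var 2]) (Call 4 [Head (Var 0), Var 1, Var 2])
       (Call 5 [Tail (Var 0), Var 1, Var 2, Head (Var 0)])
       (Call 5 [Tail (Var 0), Var 1, Var 2, Var 3]))"

definition body_clear :: expr where
  "body_clear = IfEmpty (Var 0) Empty
     (Push (IfLe (Head (Var 0)) (Var 2) Zero (Head (Var 1)))
       (Call 6 [Tail (Var 0), Tail (Var 1), Var 2]))"

text \<open>
  A row of the distance matrix identifies its point: it is the only one at distance at most 0. So a
  pivot is represented by its row, without its index.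
\<close>

definition body_mark :: expr where
  "body_mark = IfEmpty (Var 0) Empty
     (Push (IfLe (Head (Var 0)) Zero (Plus (Head (Var 1)) One) (Head (Var 1)))
       (Call 7 [Tail (Var 0), Tail (Var 1)]))"

text \<open>Truncated as on \<open>nat\<close>, in agreement with the demands of the colorful
  instances.\<close>

definition body_monus :: expr where
  "body_monus = IfLe (Var 0) (Var 1) Zero (Minus (Var 0) (Var 1))"

text \<open>
  The arguments are a list serving as a counter, the metric, \<open>u\<^sub>i\<close>, the red weight, \<open>i\<close>, the blue demand,
  \<open>r\<close>, \<open>k\<close>, and the budgets and radii of the colorful instances.
\<close>

definition body_loop :: expr where
  "body_loop =
     Push (Push (Var 1) (Push (Var 3) (Push (Var 2) (Push (Call 15 [Var 4, Var 7])
       (Push (Var 5) (Push (Var 8) (Push (Var 9) Empty)))))))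
     (IfEmpty (Var 0) Empty
       (LetIn (Call 5 [Var 1, Var 2, Var 6, Head (Var 1)])
         (LetIn (Plus (Var 7) (Plus (Var 7) (Var 7)))
           (Call 8 [Tail (Var 2), Var 3, Call 6 [Var 1, Var 4, Var 0], Call 7 [Var 1, Var 5],
              Plus (Var 6) One, Call 15 [Var 7, Call 4 [Var 1, Var 4, Var 0]],
              Var 8, Var 9, Var 10, Var 11]))))"

definition body_nth :: expr where
  "body_nth = IfLe (Var 1) Zero (Head (Var 0)) (Call 9 [Tail (Var 0), Minus (Var 1) One])"

text \<open>The row belongs to the point being tested; by symmetry of the metric, its entry at the
  index of a center decides whether the ball covers the point.\<close>

definition body_hit :: expr where
  "body_hit = IfEmpty (Var 1) Zero
     (IfLe (Call 9 [Var 0, Head (Head (Var 1))]) (Head (Tail (Head (Var 1)))) One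
       (Call 10 [Var 0, Tail (Var 1)]))"

definition body_hits :: expr where
  "body_hits = IfEmpty (Var 1) Zero
     (IfLe One (Call 10 [Var 0, Head (Var 1)]) One (Call 11 [Var 0, Tail (Var 1)]))"

text \<open>The third argument counts the points, because an output ball names its center by number.
  Inside \<open>LetIn\<close>, \<open>Var 0\<close> is the result for the later points and the
  arguments move up by one.\<close>

definition body_extra :: expr where
  "body_extra = IfEmpty (Var 0) Empty
     (LetIn (Call 12 [Tail (Var 0), Tail (Var 1), Plus (Var 2) One, Var 3, Var 4])
       (IfLe (Head (Var 2)) Zero (Var 0)
         (IfLe One (Call 11 [Head (Var 1), Var 4]) (Var 0)
           (Push (Push (Var 3) (Push (Var 5) Empty)) (Var 0)))))"

definition body_grow_balls :: expr where
  "body_grow_balls = IfEmpty (Var 0) Empty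
     (Push (Push (Head (Head (Var 0))) (Push (Plus (Head (Tail (Head (Var 0)))) (Var 1)) Empty))
       (Call 13 [Tail (Var 0), Var 1]))"

definition body_grow :: expr where
  "body_grow = IfEmpty (Var 0) (Push (Var 2) Empty)
     (Push (Call 13 [Head (Var 0), Var 1]) (Call 14 [Tail (Var 0), Var 1, Var 2]))"

definition prog :: "expr \<Rightarrow> program" where
  "prog e = [e, body_last, body_shift, body_zeros, body_ball, body_best, body_clear, body_mark,
     body_loop, body_nth, body_hit, body_hits, body_extra, body_grow_balls, body_grow, body_monus]"

section \<open>Correctness and running time of the subroutines of the reduction\<close>

lemma length_prog [simp]: "length (prog e) = 16"
  by (simp add: prog_def)

lemma call_prog:
  "call (prog e) 0 ws = sem (prog e) ws e"
  "call (prog e) (Suc 0) ws = sem (prog e) ws body_last"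
  "call (prog e) 2 ws = sem (prog e) ws body_shift"
  "call (prog e) 3 ws = sem (prog e) ws body_zeros"
  "call (prog e) 4 ws = sem (prog e) ws body_ball"
  "call (prog e) 5 ws = sem (prog e) ws body_best"
  "call (prog e) 6 ws = sem (prog e) ws body_clear"
  "call (prog e) 7 ws = sem (prog e) ws body_mark"
  "call (prog e) 8 ws = sem (prog e) ws body_loop"
  "call (prog e) 9 ws = sem (prog e) ws body_nth"
  "call (prog e) 10 ws = sem (prog e) ws body_hit"
  "call (prog e) 11 ws = sem (prog e) ws body_hits"
  "call (prog e) 12 ws = sem (prog e) ws body_extra"
  "call (prog e) 13 ws = sem (prog e) ws body_grow_balls"
  "call (prog e) 14 ws = sem (prog e) ws body_grow"
  "call (prog e) 15 ws = sem (prog e) ws body_monus"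
  by (simp_all add: call_def prog_def)

lemma runs_last:
  "vs \<noteq> [] \<Longrightarrow> runs_in (prog e) (Suc 0) [Lst vs] (last vs) (10 * length vs)"
proof (induction vs)
  case (Cons v vs)
  show ?case
  proof (cases "vs = []")
    case True
    then show ?thesis
      unfolding runs_in_def call_prog body_last_def by (simp add: sem_simps)
  next
    case False
    obtain T where T: "call (prog e) (Suc 0) [Lst vs] = Some (last vs, T)" "T \<le> 10 * length vs"
      using Cons.IH[OF False] by (rule runs_inE)
    show ?thesis
      unfolding runs_in_def call_prog body_last_def using False T by (simp add: sem_simps)
  qed
qed simp

lemma runs_shift:
  "xs \<noteq> [] \<Longrightarrow> runs_in (prog e) 2 [Lst (map Num xs), Num x]
     (Lst (map (\<lambda>y. Num (y + x)) (butlast xs))) (20 * length xs)"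
proof (induction xs)
  case (Cons y ys)
  show ?case
  proof (cases "ys = []")
    case True
    then show ?thesis
      unfolding runs_in_def call_prog body_shift_def by (simp add: sem_simps)
  next
    case False
    obtain T where T: "call (prog e) 2 [Lst (map Num ys), Num x] =
        Some (Lst (map (\<lambda>y. Num (y + x)) (butlast ys)), T)" "T \<le> 20 * length ys"
      using Cons.IH[OF False] by (rule runs_inE)
    show ?thesis
      unfolding runs_in_def call_prog body_shift_def using False T by (simp add: sem_simps)
  qed
qed simp

lemma runs_zeros:
  "runs_in (prog e) 3 [Lst (map f xs)] (Lst (map (\<lambda>_. Num 0) xs)) (10 * length xs + 5)"
proof (induction xs)
  case Nil
  show ?case unfolding runs_in_def call_prog body_zeros_def by (simp add: sem_simps)
next
  case (Cons q xs)
  then obtain T where T: "call (prog e) 3 [Lst (map f xs)] = Some (Lst (map (\<lambda>_. Num 0) xs), T)"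
    "T \<le> 10 * length xs + 5"
    by (rule runs_inE)
  show ?case unfolding runs_in_def call_prog body_zeros_def using T by (simp add: sem_simps)
qed

text \<open>Over an arbitrary list of points rather than \<open>[0..<n]\<close>, so that inductions
  can pass to the tail of a row.\<close>

definition enc_row :: "('q \<Rightarrow> real) \<Rightarrow> 'q list \<Rightarrow> val" where
  "enc_row \<delta> xs = Lst (map (\<lambda>q. Num (\<delta> q)) xs)"

definition enc_vec :: "('q \<Rightarrow> nat) \<Rightarrow> 'q list \<Rightarrow> val" where
  "enc_vec u xs = Lst (map (\<lambda>q. Num (real (u q))) xs)"

lemma enc_row_simps [simp]: "enc_row \<delta> [] = Lst []"
  "enc_row \<delta> (q # xs) = Lst (Num (\<delta> q) # map (\<lambda>q. Num (\<delta> q)) xs)"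
  by (simp_all add: enc_row_def)

lemma enc_vec_simps [simp]: "enc_vec u [] = Lst []"
  "enc_vec u (q # xs) = Lst (Num (real (u q)) # map (\<lambda>q. Num (real (u q))) xs)"
  by (simp_all add: enc_vec_def)

lemma runs_ball:
  "runs_in (prog e) 4 [enc_row \<delta> xs, enc_vec u xs, Num r]
     (Num (real (\<Sum>q\<leftarrow>xs. if \<delta> q \<le> r then u q else 0))) (20 * length xs + 5)"
proof (induction xs)
  case Nil
  show ?case unfolding runs_in_def call_prog body_ball_def by (simp add: sem_simps)
next
  case (Cons q xs)
  then obtain T where T: "call (prog e) 4 [enc_row \<delta> xs, enc_vec u xs, Num r] =
      Some (Num (real (\<Sum>q\<leftarrow>xs. if \<delta> q \<le> r then u q else 0)), T)" "T \<le> 20 * length xs + 5"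
    by (rule runs_inE)
  show ?case
    unfolding runs_in_def call_prog body_ball_def
    using T[unfolded enc_row_def enc_vec_def]
    by (cases "\<delta> q \<le> r") (simp_all add: sem_simps)
qed

lemma runs_clear:
  "runs_in (prog e) 6 [enc_row \<delta> xs, enc_vec u xs, Num r]
     (enc_vec (\<lambda>q. if \<delta> q \<le> r then 0 else u q) xs) (20 * length xs + 5)"
proof (induction xs)
  case Nil
  show ?case unfolding runs_in_def call_prog body_clear_def by (simp add: sem_simps)
next
  case (Cons q xs)
  then obtain T where T: "call (prog e) 6 [enc_row \<delta> xs, enc_vec u xs, Num r] =
      Some (enc_vec (\<lambda>q. if \<delta> q \<le> r then 0 else u q) xs, T)" "T \<le> 20 * length xs + 5"
    by (rule runs_inE)
  show ?case
    unfolding runs_in_def call_prog body_clear_def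
    using T[unfolded enc_row_def enc_vec_def]
    by (cases "\<delta> q \<le> r") (simp_all add: sem_simps)
qed

lemma runs_mark:
  "runs_in (prog e) 7 [enc_row \<delta> xs, enc_vec u xs]
     (enc_vec (\<lambda>q. if \<delta> q \<le> 0 then u q + 1 else u q) xs) (25 * length xs + 5)"
proof (induction xs)
  case Nil
  show ?case unfolding runs_in_def call_prog body_mark_def by (simp add: sem_simps)
next
  case (Cons q xs)
  then obtain T where T: "call (prog e) 7 [enc_row \<delta> xs, enc_vec u xs] =
      Some (enc_vec (\<lambda>q. if \<delta> q \<le> 0 then u q + 1 else u q) xs, T)" "T \<le> 25 * length xs + 5"
    by (rule runs_inE)
  show ?case
    unfolding runs_in_def call_prog body_mark_def
    using T[unfolded enc_row_def enc_vec_def]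
    by (cases "\<delta> q \<le> 0") (simp_all add: sem_simps add.commute)
qed

lemma runs_monus:
  "runs_in (prog e) 15 [Num (real x), Num (real y)] (Num (real (x - y))) 10"
  unfolding runs_in_def call_prog body_monus_def
  by (cases "x \<le> y") (simp_all add: sem_simps of_nat_diff)

text \<open>The choice made by \<open>body_best\<close>; ties go to the later candidate.\<close>

fun pick :: "('q \<Rightarrow> nat) \<Rightarrow> 'q \<Rightarrow> 'q list \<Rightarrow> 'q" where
  "pick v c [] = c"
| "pick v c (p # ps) = (if v c \<le> v p then pick v p ps else pick v c ps)"

lemma runs_best:
  fixes xs :: "'q list" and \<delta> :: "'p \<Rightarrow> 'q \<Rightarrow> real"
  defines "v \<equiv> \<lambda>u r p. \<Sum>q\<leftarrow>xs. if \<delta> p q \<le> r then u q else 0"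
  shows "runs_in (prog e) 5
     [Lst (map (\<lambda>p. enc_row (\<delta> p) xs) ps), enc_vec u xs, Num r, enc_row (\<delta> c) xs]
     (enc_row (\<delta> (pick (v u r) c ps)) xs) (length ps * (40 * length xs + 50) + 5)"
proof (induction ps arbitrary: c)
  case Nil
  show ?case unfolding runs_in_def call_prog body_best_def by (simp add: sem_simps)
next
  case (Cons p ps)
  have ball: "\<exists>T\<le>20 * length xs + 5. call (prog e) 4 [enc_row (\<delta> p) xs, enc_vec u xs, Num r] =
      Some (Num (real (v u r p)), T)" for p
    using runs_ball[of e "\<delta> p" xs u r] unfolding runs_in_def v_def .
  obtain T1 where T1: "T1 \<le> 20 * length xs + 5"
    "call (prog e) 4 [enc_row (\<delta> c) xs, enc_vec u xs, Num r] = Some (Num (real (v u r c)), T1)"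
    using ball by blast
  obtain T2 where T2: "T2 \<le> 20 * length xs + 5"
    "call (prog e) 4 [enc_row (\<delta> p) xs, enc_vec u xs, Num r] = Some (Num (real (v u r p)), T2)"
    using ball by blast
  show ?case
  proof (cases "v u r c \<le> v u r p")
    case True
    obtain T where T: "call (prog e) 5
        [Lst (map (\<lambda>p. enc_row (\<delta> p) xs) ps), enc_vec u xs, Num r, enc_row (\<delta> p) xs] =
      Some (enc_row (\<delta> (pick (v u r) p ps)) xs, T)" "T \<le> length ps * (40 * length xs + 50) + 5"
      using Cons.IH by (rule runs_inE)
    show ?thesis
      unfolding runs_in_def call_prog body_best_def using T1 T2 True T by (simp add: sem_simps)
  next
    case False
    obtain T where T: "call (prog e) 5
        [Lst (map (\<lambda>p. enc_row (\<delta> p) xs) ps), enc_vec u xs, Num r, enc_row (\<delta> c) xs] =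
      Some (enc_row (\<delta> (pick (v u r) c ps)) xs, T)" "T \<le> length ps * (40 * length xs + 50) + 5"
      using Cons.IH by (rule runs_inE)
    show ?thesis
      unfolding runs_in_def call_prog body_best_def using T1 T2 False T by (simp add: sem_simps)
  qed
qed

section \<open>The reduction\<close>

text \<open>A sum over a list, in the form in which the program computes it;
  \<open>ball_weight_eq\<close> turns it into a sum over a ball of the metric.\<close>

definition ball_weight :: "nat robust_nukc \<Rightarrow> (nat \<Rightarrow> nat) \<Rightarrow> real \<Rightarrow> nat \<Rightarrow> nat" where
  "ball_weight I u r p = (\<Sum>q\<leftarrow>[0..<card (points I)]. if metric_fn I p q \<le> r then u q else 0)"

text \<open>Balls are compared at radius \<open>r\<close>, whereas \<open>residual\<close> clears
  balls of radius \<open>3r\<close>. The starting candidate 0 is a point as soon as there are any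
  points.\<close>

definition heaviest :: "nat robust_nukc \<Rightarrow> (nat \<Rightarrow> nat) \<Rightarrow> nat" where
  "heaviest I u = pick (ball_weight I u (last (radii I))) 0 [0..<card (points I)]"

primrec residual :: "nat robust_nukc \<Rightarrow> nat \<Rightarrow> nat \<Rightarrow> nat" where
  "residual I 0 = weight I"
| "residual I (Suc i) = (\<lambda>q.
     if metric_fn I (heaviest I (residual I i)) q \<le> 3 * last (radii I) then 0 else residual I i q)"

definition pivot :: "nat robust_nukc \<Rightarrow> nat \<Rightarrow> nat" where
  "pivot I i = heaviest I (residual I i)"

text \<open>Pivots are counted with multiplicity: once no weight is left a pivot can be chosen
  again, yet the total must stay \<open>i\<close> to match the demand \<open>i - k\<close>. Distance
  at most 0 means equality and is what \<open>body_mark\<close> tests.\<close>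

definition marks :: "nat robust_nukc \<Rightarrow> nat \<Rightarrow> nat \<Rightarrow> nat" where
  "marks I i q = (\<Sum>j<i. if metric_fn I (pivot I j) q \<le> 0 then 1 else 0)"

text \<open>Each \<open>3r\<close>-ball is weighed by the residual at its own step, so that no point
  is subtracted twice. The truncated difference is 0 once enough weight has been cleared.\<close>

definition quota :: "nat robust_nukc \<Rightarrow> nat \<Rightarrow> nat" where
  "quota I i = demand I - (\<Sum>j<i. ball_weight I (residual I j) (3 * last (radii I)) (pivot I j))"

definition level :: "nat robust_nukc \<Rightarrow> nat \<Rightarrow> nat colorful_nukc" where
  "level I i =
     \<lparr>points = points I, metric_fn = metric_fn I, budgets = butlast (budgets I),
      radii = map (\<lambda>\<rho>. \<rho> + 3 * last (radii I)) (butlast (radii I)),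
      red = marks I i, blue = residual I i,
      red_demand = i - last (budgets I), blue_demand = quota I i\<rparr>"

text \<open>Index \<open>n\<close> is included: there all weight has been cleared, which ends the
  argument in \<open>exhausted_level\<close>.\<close>

definition levels :: "nat robust_nukc \<Rightarrow> nat colorful_nukc list" where
  "levels I = map (level I) [0..<Suc (card (points I))]"

definition hit :: "(nat \<Rightarrow> real) \<Rightarrow> (nat \<times> real) list list \<Rightarrow> bool" where
  "hit \<delta> S \<longleftrightarrow> (\<exists>bs\<in>set S. \<exists>b\<in>set bs. \<delta> (fst b) \<le> snd b)"

text \<open>Pivots are recognized by their positive red weight in \<open>J\<close>, and radii are
  read off from \<open>S\<close>, so the construction depends neither on the index of the level nor
  on the factor \<alpha>.\<close>

definition lift_balls ::
    "nat robust_nukc \<times> nat colorful_nukc \<times> (nat \<times> real) list list \<Rightarrow> (nat \<times> real) list list" where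
  "lift_balls = (\<lambda>(I, J, S). let x = 3 * last (radii I) in
     map (map (\<lambda>b. (fst b, snd b + x))) S @
     [map (\<lambda>p. (p, x))
        (filter (\<lambda>p. 0 < red J p \<and> \<not> hit (metric_fn I p) S) [0..<card (points I)])])"

lemma enc_metric_eq:
  "enc_metric I = Lst (map (\<lambda>p. enc_row (metric_fn I p) [0..<card (points I)]) [0..<card (points I)])"
  by (simp add: enc_metric_def enc_fun_def enc_row_def Let_def)

lemma enc_weights_eq: "enc_weights I w = enc_vec w [0..<card (points I)]"
  by (simp add: enc_weights_def enc_fun_def enc_vec_def enc_nat_def)

lemma enc_level:
  "enc_colorful (level I i) = Lst
     [enc_metric I, enc_vec (marks I i) [0..<card (points I)],
      enc_vec (residual I i) [0..<card (points I)],
      Num (real (i - last (budgets I))), Num (real (quota I i)),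
      Lst (map (\<lambda>k. Num (real k)) (butlast (budgets I))),
      Lst (map (\<lambda>\<rho>. Num (\<rho> + 3 * last (radii I))) (butlast (radii I)))]"
  by (simp add: enc_colorful_def level_def enc_weights_eq enc_metric_eq enc_list_def enc_nat_def
      comp_def)

text \<open>The list \<open>fuel\<close> counts the remaining rounds. Round \<open>i\<close>
  receives the data of \<open>level I i\<close>, outputs that level and passes on the data of the
  next. Its cost is dominated by the search for the pivot: \<open>n\<close> comparisons of ball
  weights, each of linear cost.\<close>

lemma runs_loop:
  assumes n: "n = card (points I)" "0 < n"
  defines "xs \<equiv> [0..<n]"
  shows "runs_in (prog e) 8
     [Lst fuel, enc_metric I, enc_vec (residual I i) xs, enc_vec (marks I i) xs,
      Num (real i), Num (real (quota I i)), Num (last (radii I)), Num (real (last (budgets I))),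
      Lst (map (\<lambda>k. Num (real k)) (butlast (budgets I))),
      Lst (map (\<lambda>\<rho>. Num (\<rho> + 3 * last (radii I))) (butlast (radii I)))]
     (Lst (map (enc_colorful \<circ> level I) [i..<Suc (i + length fuel)]))
     ((length fuel + 1) * (40 * n * n + 120 * n + 200))"
proof (induction fuel arbitrary: i)
  case Nil
  obtain T where T: "call (prog e) 15 [Num (real i), Num (real (last (budgets I)))] =
      Some (Num (real (i - last (budgets I))), T)" "T \<le> 10"
    using runs_monus by (rule runs_inE)
  show ?case
    unfolding runs_in_def call_prog body_loop_def using T
    by (simp add: sem_simps enc_level xs_def n(1))
next
  case (Cons f fuel)
  let ?p = "pivot I i" and ?r = "last (radii I)"
  \<comment> \<open>The row of point 0 is the initial candidate, so it is split off; it exists since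
    \<open>0 < n\<close>.\<close>
  have Met: "enc_metric I = Lst (enc_row (metric_fn I 0) xs # map (\<lambda>p. enc_row (metric_fn I p) xs) [1..<n])"
    using n(2) unfolding xs_def enc_metric_eq n(1)[symmetric] by (simp add: upt_conv_Cons)
  have Met': "Lst (enc_row (metric_fn I 0) xs # map (\<lambda>p. enc_row (metric_fn I p) xs) [1..<n]) =
      Lst (map (\<lambda>p. enc_row (metric_fn I p) xs) xs)"
    using n(2) unfolding xs_def by (simp add: upt_conv_Cons)
  obtain T where T: "call (prog e) 15 [Num (real i), Num (real (last (budgets I)))] =
      Some (Num (real (i - last (budgets I))), T)" "T \<le> 10"
    using runs_monus by (rule runs_inE)
  have piv: "pick (\<lambda>p. \<Sum>q\<leftarrow>xs. if metric_fn I p q \<le> ?r then residual I i q else 0) 0 xs = ?p"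
    by (simp add: pivot_def heaviest_def ball_weight_def[abs_def] xs_def n(1))
  obtain T1 where T1: "call (prog e) 5 [Lst (enc_row (metric_fn I 0) xs # map (\<lambda>p. enc_row (metric_fn I p) xs) [1..<n]), enc_vec (residual I i) xs,
      Num ?r, enc_row (metric_fn I 0) xs] = Some (enc_row (metric_fn I ?p) xs, T1)"
    "T1 \<le> n * (40 * n + 50) + 5"
    using runs_best[of e "metric_fn I" xs xs "residual I i" ?r 0]
    unfolding piv Met' by (auto elim: runs_inE simp: xs_def)
  obtain T2 where T2: "call (prog e) 6 [enc_row (metric_fn I ?p) xs, enc_vec (residual I i) xs,
      Num (3 * ?r)] = Some (enc_vec (residual I (Suc i)) xs, T2)" "T2 \<le> 20 * n + 5"
    using runs_clear[of e "metric_fn I ?p" xs "residual I i" "3 * ?r"]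
    by (auto elim: runs_inE simp: xs_def pivot_def)
  have mk: "(\<lambda>q. if metric_fn I ?p q \<le> 0 then marks I i q + 1 else marks I i q) = marks I (Suc i)"
    by (auto simp: marks_def fun_eq_iff)
  obtain T3 where T3: "call (prog e) 7 [enc_row (metric_fn I ?p) xs, enc_vec (marks I i) xs] =
      Some (enc_vec (marks I (Suc i)) xs, T3)" "T3 \<le> 25 * n + 5"
    using runs_mark[of e "metric_fn I ?p" xs "marks I i"] unfolding mk
    by (auto elim: runs_inE simp: xs_def)
  let ?w = "ball_weight I (residual I i) (3 * ?r) ?p"
  obtain T4 where T4: "call (prog e) 4 [enc_row (metric_fn I ?p) xs, enc_vec (residual I i) xs,
      Num (3 * ?r)] = Some (Num (real ?w), T4)" "T4 \<le> 20 * n + 5"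
    using runs_ball[of e "metric_fn I ?p" xs "residual I i" "3 * ?r"]
    unfolding ball_weight_def by (auto elim: runs_inE simp: xs_def n(1))
  \<comment> \<open>Truncated subtraction of the summands one by one equals that of their
    sum.\<close>
  have qt: "quota I i - ?w = quota I (Suc i)"
    by (simp add: quota_def)
  obtain T5 where T5: "call (prog e) 15 [Num (real (quota I i)), Num (real ?w)] =
      Some (Num (real (quota I (Suc i))), T5)" "T5 \<le> 10"
    using runs_monus[of e "quota I i" ?w] unfolding qt by (rule runs_inE)
  obtain T6 where T6: "call (prog e) 8
     [Lst fuel, enc_metric I, enc_vec (residual I (Suc i)) xs, enc_vec (marks I (Suc i)) xs,
      Num (real (Suc i)), Num (real (quota I (Suc i))), Num ?r, Num (real (last (budgets I))),
      Lst (map (\<lambda>k. Num (real k)) (butlast (budgets I))),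
      Lst (map (\<lambda>\<rho>. Num (\<rho> + 3 * ?r)) (butlast (radii I)))] =
     Some (Lst (map (enc_colorful \<circ> level I) [Suc i..<Suc (Suc i + length fuel)]), T6)"
    "T6 \<le> (length fuel + 1) * (40 * n * n + 120 * n + 200)"
    using Cons.IH[of "Suc i"] by (rule runs_inE)
  have hd: "[i..<Suc (i + length (f # fuel))] = i # [Suc i..<Suc (Suc i + length fuel)]"
    by (simp add: upt_conv_Cons del: upt_Suc)
  have ri: "real (Suc i) = real i + 1" by simp
  have r3: "?r + (?r + ?r) = 3 * ?r" by simp
  note lvl = enc_level[of I i, folded n(1), folded xs_def]
  show ?case
    unfolding runs_in_def call_prog body_loop_def hd
    using T T1 T2 T3 T4 T5 T6[unfolded ri]
    by (simp add: sem_simps lvl Met r3 add_mult_distrib add_mult_distrib2 del: upt_Suc residual.simps)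
qed


text \<open>Under the binder, \<open>Var 0\<close> is \<open>r\<close>. The distance matrix also
  serves as the counter of the loop: its \<open>n\<close> rows give \<open>n + 1\<close>
  levels.\<close>

definition main_reduce :: expr where
  "main_reduce = LetIn (Call 1 [Head (Tail (Tail (Tail (Tail (Var 0)))))])
     (Call 8 [Head (Var 1), Head (Var 1), Head (Tail (Var 1)), Call 3 [Head (Tail (Var 1))], Zero,
        Head (Tail (Tail (Var 1))), Var 0, Call 1 [Head (Tail (Tail (Tail (Var 1))))],
        Call 2 [Head (Tail (Tail (Tail (Var 1)))), Zero],
        Call 2 [Head (Tail (Tail (Tail (Tail (Var 1))))), Plus (Var 0) (Plus (Var 0) (Var 0))]])"

lemma length_le_val_size: "length vs \<le> sum_list (map val_size vs)"
proof (induction vs)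
  case (Cons v vs)
  have "1 \<le> val_size v" by (cases v) auto
  with Cons show ?case by simp
qed simp

lemma val_size_enc_robust:
  "card (points I) + length (budgets I) + length (radii I) \<le> val_size (enc_robust I)"
  using length_le_val_size[of "map (\<lambda>i. enc_nat (weight I i)) [0..<card (points I)]"]
    length_le_val_size[of "map enc_nat (budgets I)"] length_le_val_size[of "map Num (radii I)"]
  by (simp add: enc_robust_def enc_weights_def enc_fun_def enc_list_def)

text \<open>The loop dominates with \<open>n + 1\<close> rounds of quadratic cost; \<open>n\<close>
  and the lengths of the lists are bounded by the input size.\<close>

lemma runs_reduce:
  assumes "card (points I) > 0" "budgets I \<noteq> []" "radii I \<noteq> []"
  shows "runs_in (prog main_reduce) 0 [enc_robust I] (enc_list enc_colorful (levels I))
     (500 * (val_size (enc_robust I) + 1) ^ 3)"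
proof -
  define n where "n = card (points I)"
  define xs where "xs = [0..<n]"
  define m where "m = val_size (enc_robust I) + 1"
  define P where "P = prog main_reduce"
  have body: "call P 0 ws = sem P ws main_reduce" "length P = 16" for ws
    by (simp_all add: P_def call_prog)
  let ?r = "last (radii I)" and ?k = "last (budgets I)"
  let ?rows = "map (\<lambda>p. enc_row (metric_fn I p) xs) xs"
  have inp: "enc_robust I = Lst [Lst ?rows, enc_vec (weight I) xs, Num (real (demand I)),
      Lst (map Num (map real (budgets I))), Lst (map Num (radii I))]"
    by (simp add: enc_robust_def enc_metric_eq enc_weights_eq xs_def n_def enc_list_def
        enc_nat_def comp_def)
  obtain T1 where T1: "call P (Suc 0) [Lst (map Num (radii I))] = Some (Num ?r, T1)"
    "T1 \<le> 10 * length (radii I)"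
    using runs_last[of "map Num (radii I)" main_reduce] assms(3)
    by (auto elim: runs_inE simp: P_def last_map)
  obtain T2 where T2: "call P 3 [enc_vec (weight I) xs] = Some (enc_vec (marks I 0) xs, T2)"
    "T2 \<le> 10 * n + 5"
    using runs_zeros[of main_reduce "\<lambda>q. Num (real (weight I q))" xs]
    by (auto elim: runs_inE simp: P_def enc_vec_def marks_def xs_def)
  obtain T3 where T3: "call P (Suc 0) [Lst (map Num (map real (budgets I)))] =
      Some (Num (real ?k), T3)" "T3 \<le> 10 * length (budgets I)"
    using runs_last[of "map Num (map real (budgets I))" main_reduce] assms(2)
    by (auto elim: runs_inE simp: P_def last_map)
  obtain T4 where T4: "call P 2 [Lst (map Num (map real (budgets I))), Num 0] =
      Some (Lst (map (\<lambda>k. Num (real k)) (butlast (budgets I))), T4)" "T4 \<le> 20 * length (budgets I)"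
    using runs_shift[of "map real (budgets I)" main_reduce 0] assms(2)
    by (auto elim: runs_inE simp: P_def map_butlast[symmetric] comp_def)
  obtain T5 where T5: "call P 2 [Lst (map Num (radii I)), Num (3 * ?r)] =
      Some (Lst (map (\<lambda>\<rho>. Num (\<rho> + 3 * ?r)) (butlast (radii I))), T5)" "T5 \<le> 20 * length (radii I)"
    using runs_shift[of "radii I" main_reduce "3 * ?r"] assms(3) by (auto elim: runs_inE simp: P_def)
  \<comment> \<open>The loop starts at \<open>i = 0\<close>, where nothing is marked or cleared:
    \<open>residual I 0\<close> is \<open>weight I\<close> and \<open>quota I 0\<close> is
    \<open>demand I\<close>.\<close>
  obtain T6 where T6: "call P 8
     [Lst ?rows, Lst ?rows, enc_vec (weight I) xs, enc_vec (marks I 0) xs,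
      Num 0, Num (real (demand I)), Num ?r, Num (real ?k),
      Lst (map (\<lambda>k. Num (real k)) (butlast (budgets I))),
      Lst (map (\<lambda>\<rho>. Num (\<rho> + 3 * ?r)) (butlast (radii I)))] =
     Some (enc_list enc_colorful (levels I), T6)"
    "T6 \<le> (n + 1) * (40 * n * n + 120 * n + 200)"
    using runs_loop[of n I main_reduce ?rows 0] assms(1)
    by (auto elim: runs_inE simp: P_def n_def xs_def enc_metric_eq quota_def enc_list_def levels_def
        comp_def simp del: upt_Suc)
  have r3: "?r + (?r + ?r) = 3 * ?r" by simp
  have "runs_in P 0 [enc_robust I] (enc_list enc_colorful (levels I))
      (100 + T1 + T2 + T3 + T4 + T5 + T6)"
    unfolding runs_in_def inp body main_reduce_def
    using T1 T2 T3 T4 T5 T6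
    by (simp add: sem_simps r3 body)
  moreover have "100 + T1 + T2 + T3 + T4 + T5 + T6 \<le> 500 * m ^ 3"
  proof -
    have le: "n + length (budgets I) + length (radii I) \<le> m" "1 \<le> m"
      using val_size_enc_robust[of I] by (simp_all add: n_def m_def)
    have "n * n \<le> m * m" "n \<le> m * m" "1 \<le> m * m"
      using le by (auto intro: mult_le_mono order_trans[OF _ le_square])
    then have "40 * n * n + 120 * n + 200 \<le> 360 * (m * m)"
      unfolding mult.assoc by linarith
    moreover have "n + 1 \<le> m"
      using le(1) assms(2) by (cases "budgets I") auto
    ultimately have "(n + 1) * (40 * n * n + 120 * n + 200) \<le> m * (360 * (m * m))"
      by (intro mult_le_mono)
    with T6(2) have "T6 \<le> m * (360 * (m * m))" by (rule order_trans)
    moreover have "100 + T1 + T2 + T3 + T4 + T5 \<le> 140 * m"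
      using T1(2) T2(2) T3(2) T4(2) T5(2) le by linarith
    moreover have "m \<le> m ^ 3" using le(2) by (simp add: self_le_power)
    moreover have "m * (360 * (m * m)) = 360 * m ^ 3" by (simp add: power3_eq_cube)
    ultimately show ?thesis by linarith
  qed
  ultimately show ?thesis unfolding P_def m_def by (rule runs_in_mono)
qed

section \<open>Correctness and running time of the lifting program\<close>

lemma runs_nth:
  "i < length vs \<Longrightarrow> runs_in (prog e) 9 [Lst vs, Num (real i)] (vs ! i) (20 * i + 20)"
proof (induction i arbitrary: vs)
  case 0
  then obtain v ws where "vs = v # ws" by (cases vs) auto
  then show ?case
    unfolding runs_in_def call_prog body_nth_def by (simp add: sem_simps)
next
  case (Suc i)
  then obtain v ws where vs: "vs = v # ws" "i < length ws" by (cases vs) auto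
  obtain T where T: "call (prog e) 9 [Lst ws, Num (real i)] = Some (ws ! i, T)" "T \<le> 20 * i + 20"
    using Suc.IH[OF vs(2)] by (rule runs_inE)
  show ?case
    unfolding runs_in_def call_prog body_nth_def using vs T by (simp add: sem_simps)
qed

lemma runs_hit:
  assumes "\<forall>b\<in>set bs. fst b < n"
  shows "runs_in (prog e) 10 [enc_row \<delta> [0..<n], Lst (map enc_ball bs)]
     (Num (of_bool (hit \<delta> [bs]))) (length bs * (20 * n + 50) + 5)"
  using assms
proof (induction bs)
  case Nil
  show ?case unfolding runs_in_def call_prog body_hit_def by (simp add: sem_simps hit_def)
next
  case (Cons b bs)
  from Cons obtain T where T: "call (prog e) 10 [enc_row \<delta> [0..<n], Lst (map enc_ball bs)] =
      Some (Num (of_bool (hit \<delta> [bs])), T)" "T \<le> length bs * (20 * n + 50) + 5"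
    by (auto elim: runs_inE)
  have b: "fst b < n" using Cons.prems by simp
  obtain U where U: "call (prog e) 9 [enc_row \<delta> [0..<n], Num (real (fst b))] =
      Some (Num (\<delta> (fst b)), U)" "U \<le> 20 * n + 20"
    using runs_nth[of "fst b" "map (\<lambda>q. Num (\<delta> q)) [0..<n]" e] b
    by (auto elim!: runs_inE simp: enc_row_def)
  have eq: "hit \<delta> [b # bs] \<longleftrightarrow> \<delta> (fst b) \<le> snd b \<or> hit \<delta> [bs]"
    by (simp add: hit_def)
  show ?case
    unfolding runs_in_def call_prog body_hit_def eq using T U
    by (cases "\<delta> (fst b) \<le> snd b") (simp_all add: sem_simps enc_ball_def enc_nat_def)
qed

text \<open>The bound of \<open>runs_hit\<close> summed over the sets of balls, with 30 further
  steps per set.\<close>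

definition hits_time :: "nat \<Rightarrow> 'b list list \<Rightarrow> nat" where
  "hits_time n S = length (concat S) * (20 * n + 50) + 30 * length S + 5"

lemma runs_hits:
  assumes "\<forall>bs\<in>set S. \<forall>b\<in>set bs. fst b < n"
  shows "runs_in (prog e) 11 [enc_row \<delta> [0..<n], enc_balls S]
     (Num (of_bool (hit \<delta> S))) (hits_time n S)"
  using assms
proof (induction S)
  case Nil
  show ?case unfolding runs_in_def call_prog body_hits_def enc_balls_def enc_list_def
    by (simp add: sem_simps hit_def hits_time_def)
next
  case (Cons bs S)
  then obtain T where T: "call (prog e) 11 [enc_row \<delta> [0..<n], Lst (map (enc_list enc_ball) S)] =
      Some (Num (of_bool (hit \<delta> S)), T)" "T \<le> hits_time n S"
    by (auto elim: runs_inE simp: enc_balls_def enc_list_def)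
  obtain U where U: "call (prog e) 10 [enc_row \<delta> [0..<n], enc_list enc_ball bs] =
      Some (Num (of_bool (hit \<delta> [bs])), U)" "U \<le> length bs * (20 * n + 50) + 5"
    using runs_hit[of bs n e \<delta>] Cons.prems by (auto elim: runs_inE simp: enc_list_def)
  have eq: "hit \<delta> (bs # S) \<longleftrightarrow> hit \<delta> [bs] \<or> hit \<delta> S"
    by (simp add: hit_def)
  have time: "hits_time n (bs # S) = hits_time n S + length bs * (20 * n + 50) + 30"
    by (simp add: hits_time_def add_mult_distrib)
  show ?case
    unfolding runs_in_def call_prog body_hits_def eq time enc_balls_def enc_list_def[of "enc_list enc_ball"] using T U
    by (cases "hit \<delta> [bs]") (simp_all add: sem_simps)
qed

text \<open>The tested points form a segment starting at \<open>i\<close>, so that the induction can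
  advance the counter, while each row still lists the distances to all \<open>n\<close>
  points.\<close>

lemma runs_extra:
  fixes x :: real
  assumes "\<forall>bs\<in>set S. \<forall>b\<in>set bs. fst b < n"
  shows "runs_in (prog e) 12
     [Lst (map (\<lambda>p. enc_row (d p) [0..<n]) [i..<i + m]), enc_vec R [i..<i + m], Num (real i),
      enc_balls S, Num x]
     (enc_list enc_ball (map (\<lambda>p. (p, x)) (filter (\<lambda>p. 0 < R p \<and> \<not> hit (d p) S) [i..<i + m])))
     (m * (hits_time n S + 60) + 5)"
proof (induction m arbitrary: i)
  case 0
  show ?case unfolding runs_in_def call_prog body_extra_def
    by (simp add: sem_simps enc_list_def)
next
  case (Suc m)
  let ?res = "\<lambda>ps. map enc_ball (map (\<lambda>p. (p, x)) (filter (\<lambda>p. 0 < R p \<and> \<not> hit (d p) S) ps))"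
  have ri: "real (Suc i) = real i + 1" by simp
  obtain T where T: "call (prog e) 12
     [Lst (map (\<lambda>p. enc_row (d p) [0..<n]) [Suc i..<Suc i + m]),
      Lst (map (\<lambda>q. Num (real (R q))) [Suc i..<Suc i + m]), Num (real i + 1),
      enc_balls S, Num x] =
     Some (Lst (?res [Suc i..<Suc i + m]), T)" "T \<le> m * (hits_time n S + 60) + 5"
    using Suc[of "Suc i"] unfolding enc_vec_def enc_list_def ri by (rule runs_inE)
  obtain U where U: "call (prog e) 11 [enc_row (d i) [0..<n], enc_balls S] =
      Some (Num (of_bool (hit (d i) S)), U)" "U \<le> hits_time n S"
    using runs_hits[OF assms] by (rule runs_inE)
  have upt: "[i..<i + Suc m] = i # [Suc i..<Suc i + m]"
    by (simp add: upt_conv_Cons del: upt_Suc)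
  show ?case
    unfolding runs_in_def call_prog body_extra_def upt enc_list_def using T U
    by (cases "R i = 0"; cases "hit (d i) S")
      (simp_all add: sem_simps enc_ball_def enc_nat_def del: upt_Suc)
qed

lemma runs_grow_balls:
  "runs_in (prog e) 13 [enc_list enc_ball bs, Num x]
     (enc_list enc_ball (map (\<lambda>b. (fst b, snd b + x)) bs)) (30 * length bs + 5)"
proof (induction bs)
  case Nil
  show ?case unfolding runs_in_def call_prog body_grow_balls_def
    by (simp add: sem_simps enc_list_def)
next
  case (Cons b bs)
  obtain T where T: "call (prog e) 13 [Lst (map enc_ball bs), Num x] =
     Some (Lst (map enc_ball (map (\<lambda>b. (fst b, snd b + x)) bs)), T)" "T \<le> 30 * length bs + 5"
    using Cons unfolding enc_list_def by (rule runs_inE)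
  show ?case
    unfolding runs_in_def call_prog body_grow_balls_def enc_list_def using T
    by (simp add: sem_simps enc_ball_def)
qed

lemma runs_grow:
  "runs_in (prog e) 14 [enc_balls S, Num x, enc_list enc_ball E]
     (enc_balls (map (map (\<lambda>b. (fst b, snd b + x))) S @ [E]))
     (30 * length (concat S) + 40 * length S + 5)"
proof (induction S)
  case Nil
  show ?case unfolding runs_in_def call_prog body_grow_def enc_balls_def
    by (simp add: sem_simps enc_list_def)
next
  case (Cons bs S)
  let ?g = "map (\<lambda>b. (fst b, snd b + x)) :: _ \<Rightarrow> (nat \<times> real) list"
  obtain T where T: "call (prog e) 14 [Lst (map (enc_list enc_ball) S), Num x, enc_list enc_ball E] =
     Some (Lst (map (enc_list enc_ball) (map ?g S @ [E])), T)"
     "T \<le> 30 * length (concat S) + 40 * length S + 5"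
    using Cons unfolding enc_balls_def enc_list_def[of "enc_list enc_ball"] by (rule runs_inE)
  obtain U where U: "call (prog e) 13 [enc_list enc_ball bs, Num x] =
     Some (enc_list enc_ball (?g bs), U)" "U \<le> 30 * length bs + 5"
    using runs_grow_balls by (rule runs_inE)
  show ?case
    unfolding runs_in_def call_prog body_grow_def enc_balls_def enc_list_def[of "enc_list enc_ball"]
    using T U
    by (simp add: sem_simps)
qed

text \<open>Under the three binders, \<open>Var 0\<close> is \<open>3r\<close>, \<open>Var 2\<close>
  the robust instance and \<open>Var 3\<close> the input triple; the red weights are the second
  entry of its second component.\<close>

definition main_lift :: expr where
  "main_lift = LetIn (Head (Var 0)) (LetIn (Call 1 [Head (Tail (Tail (Tail (Tail (Var 0)))))])
     (LetIn (Plus (Var 0) (Plus (Var 0) (Var 0)))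
       (Call 14 [Head (Tail (Tail (Var 3))), Var 0,
          Call 12 [Head (Var 2), Head (Tail (Head (Tail (Var 3)))), Zero,
            Head (Tail (Tail (Var 3))), Var 0]])))"

lemma val_size_enc_balls: "length (concat S) + length S \<le> val_size (enc_balls S)"
proof (induction S)
  case (Cons bs S)
  have "length bs \<le> sum_list (map val_size (map enc_ball bs))"
    using length_le_val_size[of "map enc_ball bs"] by simp
  with Cons show ?case by (simp add: enc_balls_def enc_list_def)
qed simp

text \<open>Cubic because each of the \<open>n\<close> points may be tested against every ball, and
  looking up a distance in a row takes linear time.\<close>

lemma runs_lift:
  assumes "\<forall>bs\<in>set S. \<forall>b\<in>set bs. fst b < card (points I)" "radii I \<noteq> []" "points J = points I"
  shows "runs_in (prog main_lift) 0 [enc_triple (I, J, S)] (enc_balls (lift_balls (I, J, S)))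
     (500 * (val_size (enc_triple (I, J, S)) + 1) ^ 3)"
proof -
  define n where "n = card (points I)"
  define xs where "xs = [0..<n]"
  define m where "m = val_size (enc_triple (I, J, S)) + 1"
  define P where "P = prog main_lift"
  define E where "E = map (\<lambda>p. (p, 3 * last (radii I)))
    (filter (\<lambda>p. 0 < red J p \<and> \<not> hit (metric_fn I p) S) xs)"
  have body: "call P 0 ws = sem P ws main_lift" "length P = 16" for ws
    by (simp_all add: P_def call_prog)
  let ?r = "last (radii I)"
  let ?rows = "map (\<lambda>p. enc_row (metric_fn I p) xs) xs"
  obtain J1 J2 where inp: "enc_triple (I, J, S) = Lst [Lst [Lst ?rows, enc_weights I (weight I), enc_nat (demand I),
      enc_list enc_nat (budgets I), Lst (map Num (radii I))], Lst (J1 # enc_vec (red J) xs # J2), enc_balls S]"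
    by (simp add: enc_triple_def enc_robust_def enc_colorful_def enc_metric_eq
        enc_weights_eq[of J] assms(3) xs_def n_def enc_list_def comp_def)
  obtain T1 where T1: "call P (Suc 0) [Lst (map Num (radii I))] = Some (Num ?r, T1)"
    "T1 \<le> 10 * length (radii I)"
    using runs_last[of "map Num (radii I)" main_lift] assms(2)
    by (auto elim: runs_inE simp: P_def last_map)
  obtain T2 where T2: "call P 12 [Lst ?rows, enc_vec (red J) xs, Num 0, enc_balls S, Num (3 * ?r)] =
      Some (enc_list enc_ball E, T2)" "T2 \<le> n * (hits_time n S + 60) + 5"
    using runs_extra[OF assms(1), of main_lift "metric_fn I" 0 n "red J" "3 * ?r"]
    by (auto elim: runs_inE simp: P_def xs_def n_def E_def)
  obtain T3 where T3: "call P 14 [enc_balls S, Num (3 * ?r), enc_list enc_ball E] =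
      Some (enc_balls (lift_balls (I, J, S)), T3)"
      "T3 \<le> 30 * length (concat S) + 40 * length S + 5"
    using runs_grow[of main_lift S "3 * ?r" E]
    by (auto elim: runs_inE simp: P_def E_def lift_balls_def Let_def xs_def n_def)
  have r3: "?r + (?r + ?r) = 3 * ?r" by simp
  have "runs_in P 0 [enc_triple (I, J, S)] (enc_balls (lift_balls (I, J, S)))
      (100 + T1 + T2 + T3)"
    unfolding runs_in_def inp body main_lift_def
    using T1 T2 T3
    by (simp add: sem_simps r3 body)
  moreover have "100 + T1 + T2 + T3 \<le> 500 * m ^ 3"
  proof -
    have le: "n + length (radii I) + length (concat S) + length S \<le> m" "1 \<le> m"
      using val_size_enc_robust[of I] val_size_enc_balls[of S]
      by (simp_all add: n_def m_def enc_triple_def)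
    then have "length (concat S) * (20 * n + 50) \<le> m * (70 * m)"
      by (intro mult_le_mono) simp_all
    moreover have "m \<le> m * m" by simp
    ultimately have "hits_time n S + 60 \<le> 165 * (m * m)"
      using le unfolding hits_time_def by linarith
    then have "T2 \<le> m * (165 * (m * m)) + 5"
      using T2(2) mult_le_mono[of n m "hits_time n S + 60" "165 * (m * m)"] le(1) by linarith
    moreover have "105 + T1 + T3 \<le> 200 * m"
      using T1(2) T3(2) le by linarith
    moreover have "m \<le> m ^ 3" using le(2) by (simp add: self_le_power)
    moreover have "m * (165 * (m * m)) = 165 * m ^ 3" by (simp add: power3_eq_cube)
    ultimately show ?thesis by linarith
  qed
  ultimately show ?thesis unfolding P_def m_def by (rule runs_in_mono)
qed

section \<open>Correctness of the reduction\<close>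

lemma pick_in: "pick v c ps \<in> insert c (set ps)"
  by (induction ps arbitrary: c) auto

text \<open>Each comparison keeps a candidate at least as heavy as the one it discards, and the
  final pick is at least as heavy as every candidate ever kept.\<close>

lemma pick_max: "q \<in> insert c (set ps) \<Longrightarrow> v q \<le> v (pick v c ps)"
proof (induction ps arbitrary: c q)
  case (Cons p ps)
  show ?case
  proof (cases "v c \<le> v p")
    case True
    then show ?thesis
      using Cons.prems Cons.IH[of q p] Cons.IH[of p p] by auto
  next
    case False
    then show ?thesis
      using Cons.prems Cons.IH[of q c] Cons.IH[of c c] by auto
  qed
qed simp

section \<open>Basic facts about a fixed robust instance\<close>

locale robust_nukc_instance =
  fixes I :: "nat robust_nukc" and t :: nat
  assumes numbered: "numbered I" and t_ge_2: "2 \<le> t" and robust: "robust_instance t I"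
begin

abbreviation "X \<equiv> points I"
abbreviation "d \<equiv> metric_fn I"
abbreviation "r \<equiv> last (radii I)"
abbreviation "k \<equiv> last (budgets I)"
abbreviation "n \<equiv> card X"

sublocale Metric_space X d
  using robust unfolding robust_instance_def nukc_frame_def by blast

lemma finite_X [simp]: "finite X"
  and length_radii: "length (radii I) = t"
  and length_budgets: "length (budgets I) = t"
  and sorted_radii: "sorted_wrt (\<ge>) (radii I)"
  and radii_nonneg: "\<rho> \<in> set (radii I) \<Longrightarrow> 0 \<le> \<rho>"
  using robust unfolding robust_instance_def nukc_frame_def by blast+

lemma radii_nonempty: "radii I \<noteq> []" and budgets_nonempty: "budgets I \<noteq> []"
  using length_radii length_budgets t_ge_2 by auto

lemma r_nonneg [simp]: "0 \<le> r"
  using radii_nonneg radii_nonempty by simp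

lemma r_le_3r: "r \<le> 3 * r"
  using r_nonneg by linarith

lemma last_eq_nth: "radii I ! (t - 1) = r" "budgets I ! (t - 1) = k"
  using radii_nonempty budgets_nonempty length_radii length_budgets by (simp_all add: last_conv_nth)

lemma X_eq: "X = {..<n}"
  using numbered unfolding numbered_def .

lemma upto_n: "{0..<n} = X"
  unfolding atLeast0LessThan by (rule X_eq[symmetric])

lemma mem_X: "p \<in> X \<longleftrightarrow> p < n"
proof -
  have "p \<in> X \<longleftrightarrow> p \<in> {0..<n}" unfolding upto_n ..
  then show ?thesis by simp
qed

text \<open>An empty point set has weight 0, below the demand, which is at least 1.\<close>

lemma n_pos: "0 < n"
  using robust unfolding robust_instance_def by (cases "X = {}") (auto simp: card_gt_0_iff)

lemma ball_weight_eq: "ball_weight I u \<rho> p = (\<Sum>q | q \<in> X \<and> d p q \<le> \<rho>. u q)"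
proof -
  have "ball_weight I u \<rho> p = (\<Sum>q\<in>X. if d p q \<le> \<rho> then u q else 0)"
    unfolding ball_weight_def interv_sum_list_conv_sum_set_nat
    by (simp add: upto_n)
  then show ?thesis by (simp add: sum.inter_filter)
qed

lemma pivot_in [simp]: "pivot I i \<in> X"
proof -
  have "pivot I i \<in> insert 0 (set [0..<n])"
    unfolding pivot_def heaviest_def by (rule pick_in)
  then show ?thesis using n_pos by (auto simp: mem_X)
qed

lemma pivot_max:
  assumes "q \<in> X"
  shows "ball_weight I (residual I i) r q \<le> ball_weight I (residual I i) r (pivot I i)"
proof -
  have "q \<in> insert 0 (set [0..<n])" using assms by (simp add: mem_X)
  then show ?thesis unfolding pivot_def heaviest_def by (rule pick_max)
qed

section \<open>Cleared points, residual weights and marks\<close>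

definition cleared :: "nat \<Rightarrow> nat set" where
  "cleared i = {q \<in> X. \<exists>j<i. d (pivot I j) q \<le> 3 * r}"

lemma cleared_subset: "cleared i \<subseteq> X"
  by (auto simp: cleared_def)

lemma residual_Suc:
  "residual I (Suc i) = (\<lambda>q. if d (pivot I i) q \<le> 3 * r then 0 else residual I i q)"
  by (simp add: pivot_def)

declare residual.simps(2) [simp del]

lemma residual_eq: "q \<in> X \<Longrightarrow> residual I i q = (if q \<in> cleared i then 0 else weight I q)"
  by (induction i) (auto simp: cleared_def residual_Suc less_Suc_eq)

lemma sum_residual:
  assumes "Y \<subseteq> X"
  shows "sum (residual I i) Y = sum (weight I) (Y - cleared i)"
proof -
  have "finite Y" using assms finite_X by (rule finite_subset)
  have "sum (residual I i) Y = sum (\<lambda>q. if q \<in> cleared i then 0 else weight I q) Y"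
    using assms by (intro sum.cong) (auto simp: residual_eq)
  also have "\<dots> = sum (weight I) (Y - cleared i)"
    by (rule sum.mono_neutral_cong_right) (use \<open>finite Y\<close> in auto)
  finally show ?thesis .
qed

lemma weight_cleared_Suc:
  "sum (weight I) (cleared (Suc i)) =
     sum (weight I) (cleared i) + sum (residual I i) {q \<in> X. d (pivot I i) q \<le> 3 * r}"
proof -
  let ?B = "{q \<in> X. d (pivot I i) q \<le> 3 * r}"
  have eq: "cleared (Suc i) = cleared i \<union> (?B - cleared i)"
    by (auto simp: cleared_def less_Suc_eq)
  have "finite (cleared i)" using cleared_subset finite_X by (rule finite_subset)
  then have "sum (weight I) (cleared (Suc i)) =
      sum (weight I) (cleared i) + sum (weight I) (?B - cleared i)"
    unfolding eq by (intro sum.union_disjoint) auto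
  then show ?thesis by (simp add: sum_residual)
qed

text \<open>The residual counts a point only at the first step that clears it, so the subtracted
  ball weights add up to the weight of \<open>cleared i\<close>.\<close>

lemma quota_eq: "quota I i = demand I - sum (weight I) (cleared i)"
proof -
  have "(\<Sum>j<i. ball_weight I (residual I j) (3 * r) (pivot I j)) = sum (weight I) (cleared i)"
  proof (induction i)
    case 0
    show ?case by (simp add: cleared_def)
  next
    case (Suc i)
    then show ?case by (simp add: weight_cleared_Suc ball_weight_eq)
  qed
  then show ?thesis unfolding quota_def by simp
qed

text \<open>Double counting over steps and points. Steps are counted rather than distinct pivots, so
  \<open>Y = X\<close> gives exactly \<open>i\<close>.\<close>

lemma sum_marks:
  assumes "Y \<subseteq> X"
  shows "sum (marks I i) Y = card {j. j < i \<and> pivot I j \<in> Y}"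
proof -
  have "finite Y" using assms finite_X by (rule finite_subset)
  have "sum (marks I i) Y = (\<Sum>q\<in>Y. \<Sum>j<i. if pivot I j = q then 1 else 0)"
    unfolding marks_def
  proof (intro sum.cong refl)
    fix q j assume "q \<in> Y"
    then have "d (pivot I j) q \<le> 0 \<longleftrightarrow> pivot I j = q"
      using assms by (metis nonneg order_antisym pivot_in subsetD zero)
    then show "(if d (pivot I j) q \<le> 0 then 1 else 0) = (if pivot I j = q then 1 else (0::nat))"
      by simp
  qed
  also have "\<dots> = (\<Sum>j<i. \<Sum>q\<in>Y. if pivot I j = q then 1 else 0)"
    by (rule sum.swap)
  also have "\<dots> = (\<Sum>j<i. if pivot I j \<in> Y then 1 else 0)"
    using \<open>finite Y\<close> by simp
  also have "\<dots> = card {j. j < i \<and> pivot I j \<in> Y}"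
    by (simp flip: sum.inter_filter)
  finally show ?thesis .
qed

text \<open>Stated for any \<open>J\<close> over the same metric, so that it serves \<open>I\<close>
  and all its levels.\<close>

lemma mem_covered:
  assumes "points J = X" "metric_fn J = d"
  shows "q \<in> covered J \<B> \<longleftrightarrow>
    q \<in> X \<and> (\<exists>s\<in>set \<B>. \<exists>b\<in>s. fst b \<in> X \<and> d (fst b) q \<le> snd b)"
  unfolding covered_def assms by force

lemma level_simps [simp]:
  "points (level I i) = X" "metric_fn (level I i) = d" "budgets (level I i) = butlast (budgets I)"
  "radii (level I i) = map (\<lambda>\<rho>. \<rho> + 3 * r) (butlast (radii I))"
  "red (level I i) = marks I i" "blue (level I i) = residual I i"
  "red_demand (level I i) = i - k" "blue_demand (level I i) = quota I i"
  by (simp_all add: level_def)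

lemma colorful_instance_level: "colorful_instance (t - 1) (level I i)"
proof -
  have "sorted_wrt (\<ge>) (butlast (radii I) @ [r])"
    using sorted_radii radii_nonempty by simp
  then have "sorted_wrt (\<ge>) (butlast (radii I))"
    unfolding sorted_wrt_append by blast
  moreover have "\<forall>\<rho>\<in>set (butlast (radii I)). 0 \<le> \<rho> + 3 * r"
    using radii_nonneg r_nonneg by (meson add_nonneg_nonneg in_set_butlastD mult_nonneg_nonneg zero_le_numeral)
  ultimately show ?thesis
    unfolding colorful_instance_def nukc_frame_def
    using Metric_space_axioms length_radii length_budgets by (simp add: sorted_wrt_map)
qed

subsection \<open>Lifting\<close>

lemma lift_solution:
  assumes "0 \<le> \<alpha>" and sol: "colorful_approx_solution \<alpha> (level I i) (map set S)"
  defines "\<B> \<equiv> map set (lift_balls (I, level I i, S))"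
  shows "within_budgets I \<B>" "robust_covers I \<B>"
    "\<forall>i<t. \<forall>(p, \<rho>)\<in>\<B> ! i. 0 \<le> \<rho> \<and> \<rho> \<le> \<alpha> * radii I ! i + (3 * \<alpha> + 3) * r"
proof -
  define Y where "Y = covered I (map set S)"
  have Y: "covered (level I i) (map set S) = Y"
    by (simp add: Y_def covered_def)
  have "Y \<subseteq> X" by (auto simp: Y_def mem_covered)
  have len: "length S = t - 1"
    and card_S: "\<And>j. j < t - 1 \<Longrightarrow> card (set (S ! j)) \<le> budgets I ! j"
    and centres: "\<And>j b. j < t - 1 \<Longrightarrow> b \<in> set (S ! j) \<Longrightarrow> fst b \<in> X"
    and rad_S: "\<And>j b. j < t - 1 \<Longrightarrow> b \<in> set (S ! j) \<Longrightarrow> snd b = \<alpha> * (radii I ! j + 3 * r)"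
    using sol unfolding colorful_approx_solution_def within_budgets_def scaled_radii_def
    by (auto simp: length_budgets length_radii nth_butlast split_beta)
  have centre: "fst b \<in> X" if "bs \<in> set S" "b \<in> set bs" for bs b
    using that centres len by (metis in_set_conv_nth)
  have red: "i - k \<le> sum (marks I i) Y" and blue: "quota I i \<le> sum (residual I i) Y"
    using sol unfolding colorful_approx_solution_def colorful_covers_def Y by simp_all
  define E where "E = {p \<in> X. 0 < marks I i p \<and> p \<notin> Y}"
  \<comment> \<open>\<open>hit\<close> measures from the point, \<open>covered\<close> from the
    center; symmetry reconciles the two.\<close>
  have hit_iff: "hit (d p) S \<longleftrightarrow> p \<in> Y" if "p \<in> X" for p
    using that centre by (auto simp: hit_def Y_def mem_covered commute)
  define grow where "grow = (\<lambda>b :: nat \<times> real. (fst b, snd b + 3 * r))"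
  have "{p. p < n \<and> 0 < marks I i p \<and> \<not> hit (d p) S} = E"
  proof -
    show ?thesis unfolding E_def using hit_iff by (auto simp: mem_X)
  qed
  then have B_eq: "\<B> = map (\<lambda>bs. grow ` set bs) S @ [(\<lambda>p. (p, 3 * r)) ` E]"
    by (auto simp: \<B>_def lift_balls_def Let_def grow_def[symmetric] E_def conj_commute)
  have nth_B: "\<B> ! j = grow ` set (S ! j)" if "j < t - 1" for j
    using that len by (simp add: B_eq nth_append)
  have last_B: "\<B> ! (t - 1) = (\<lambda>p. (p, 3 * r)) ` E"
    using len by (simp add: B_eq nth_append)
  have len_B: "length \<B> = t" using len t_ge_2 by (simp add: B_eq)
  have cases_t: "j < t - 1 \<or> j = t - 1" if "j < t" for j using that by auto
  have "finite E" by (simp add: E_def)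
  \<comment> \<open>Every point of \<open>E\<close> carries a mark, \<open>E\<close> is disjoint
    from \<open>Y\<close>, and of the \<open>i\<close> marks in total at least \<open>i - k\<close>
    lie in \<open>Y\<close>.\<close>
  have "card E \<le> k"
  proof -
    have "card E = (\<Sum>p\<in>E. 1)" by simp
    also have "\<dots> \<le> sum (marks I i) E"
      by (rule sum_mono) (auto simp: E_def)
    finally have "card E \<le> sum (marks I i) E" .
    moreover have "sum (marks I i) E + sum (marks I i) Y \<le> sum (marks I i) X"
    proof -
      have "sum (marks I i) E + sum (marks I i) Y = sum (marks I i) (E \<union> Y)"
        using \<open>Y \<subseteq> X\<close> by (intro sum.union_disjoint[symmetric]) (auto simp: E_def intro: finite_subset)
      also have "\<dots> \<le> sum (marks I i) X"
        using \<open>Y \<subseteq> X\<close> by (intro sum_mono2) (auto simp: E_def)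
      finally show ?thesis .
    qed
    moreover have "sum (marks I i) X = i" by (simp add: sum_marks)
    ultimately show ?thesis using red by linarith
  qed
  show "within_budgets I \<B>"
    unfolding within_budgets_def
  proof (intro conjI allI impI)
    show "length \<B> = length (budgets I)" using len_B length_budgets by simp
  next
    fix j assume "j < length \<B>"
    then consider "j < t - 1" | "j = t - 1" using len_B cases_t by auto
    then show "finite (\<B> ! j)" by cases (simp_all only: nth_B last_B finite_imageI finite_set \<open>finite E\<close>)
  next
    fix j assume "j < length \<B>"
    then consider "j < t - 1" | "j = t - 1" using len_B cases_t by auto
    then show "card (\<B> ! j) \<le> budgets I ! j"
    proof cases
      case 1
      have "card (grow ` set (S ! j)) \<le> card (set (S ! j))" by (rule card_image_le) simp
      then show ?thesis using card_S[OF 1] nth_B[OF 1] by simp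
    next
      case 2
      have "card ((\<lambda>p. (p, 3 * r)) ` E) \<le> card E" by (rule card_image_le[OF \<open>finite E\<close>])
      then show ?thesis using \<open>card E \<le> k\<close> unfolding 2 last_B last_eq_nth by linarith
    qed
  next
    fix j assume "j < length \<B>"
    then consider "j < t - 1" | "j = t - 1" using len_B cases_t by auto
    then show "\<forall>(p, \<rho>)\<in>\<B> ! j. p \<in> X"
    proof cases
      case 1
      then show ?thesis using centres by (auto simp: nth_B grow_def)
    next
      case 2
      then show ?thesis unfolding 2 last_B by (auto simp: E_def)
    qed
  qed
  show "\<forall>i<t. \<forall>(p, \<rho>)\<in>\<B> ! i. 0 \<le> \<rho> \<and> \<rho> \<le> \<alpha> * radii I ! i + (3 * \<alpha> + 3) * r"
  proof (intro allI impI)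
    fix j assume "j < t"
    then have "0 \<le> radii I ! j" using radii_nonneg length_radii by simp
    from \<open>j < t\<close> consider "j < t - 1" | "j = t - 1" using cases_t by auto
    then show "\<forall>(p, \<rho>)\<in>\<B> ! j. 0 \<le> \<rho> \<and> \<rho> \<le> \<alpha> * radii I ! j + (3 * \<alpha> + 3) * r"
    proof cases
      case 1
      \<comment> \<open>The radius is exactly \<alpha> times \<open>radii I ! j + 3 * r\<close>,
        plus \<open>3 * r\<close>, which is the stated bound.\<close>
      then show ?thesis using rad_S \<open>0 \<le> radii I ! j\<close> \<open>0 \<le> \<alpha>\<close>
        by (auto simp: nth_B grow_def algebra_simps)
    next
      case 2
      \<comment> \<open>The new balls have radius \<open>3 * r\<close>; the bound exceeds this by
        four times \<alpha> \<open>* r\<close>.\<close>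
      have "0 \<le> \<alpha> * r" using \<open>0 \<le> \<alpha>\<close> by simp
      then show ?thesis unfolding 2 last_B last_eq_nth by (auto simp: algebra_simps)
    qed
  qed
  define Z where "Z = covered I \<B>"
  have "Z \<subseteq> X" by (auto simp: Z_def mem_covered)
  \<comment> \<open>Enlarging all balls by \<open>3 * r\<close> covers everything within
    \<open>3 * r\<close> of \<open>Y\<close>, by the triangle inequality.\<close>
  have near_Y: "q \<in> Z" if "q \<in> X" "y \<in> Y" "d y q \<le> 3 * r" for y q
  proof -
    from \<open>y \<in> Y\<close> obtain bs b where b: "bs \<in> set S" "b \<in> set bs" "fst b \<in> X" "d (fst b) y \<le> snd b" "y \<in> X"
      by (auto simp: Y_def mem_covered)
    have "d (fst b) q \<le> snd b + 3 * r"
      using triangle[OF b(3) b(5) \<open>q \<in> X\<close>] b(4) that(3) by linarith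
    moreover have "grow b \<in> grow ` set bs" using b(2) by simp
    ultimately show ?thesis
      unfolding Z_def mem_covered[OF refl refl] B_eq using b(1,3) \<open>q \<in> X\<close>
      by (auto simp: grow_def)
  qed
  have "Y \<subseteq> Z"
    using near_Y \<open>Y \<subseteq> X\<close> by (metis mdist_zero mult_nonneg_nonneg r_nonneg subset_iff zero_le_numeral)
  \<comment> \<open>A cleared point is within \<open>3 * r\<close> of a pivot, which either lies in
    \<open>Y\<close> or is itself the center of a new ball.\<close>
  moreover have "cleared i \<subseteq> Z"
  proof
    fix q assume "q \<in> cleared i"
    then obtain j where j: "q \<in> X" "j < i" "d (pivot I j) q \<le> 3 * r" by (auto simp: cleared_def)
    show "q \<in> Z"
    proof (cases "pivot I j \<in> Y")
      case True
      then show ?thesis using near_Y j by blast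
    next
      case False
      \<comment> \<open>Step \<open>j\<close> contributes a mark to its own pivot, which puts the
        pivot into \<open>E\<close>.\<close>
      have "0 < sum (marks I i) {pivot I j}"
        using \<open>j < i\<close> by (subst sum_marks) (auto simp: card_gt_0_iff)
      with False have "pivot I j \<in> E" by (simp add: E_def)
      with j have "\<exists>b\<in>(\<lambda>p. (p, 3 * r)) ` E. fst b \<in> X \<and> d (fst b) q \<le> snd b"
        by (intro bexI[of _ "(pivot I j, 3 * r)"]) simp_all
      then show ?thesis
        unfolding Z_def mem_covered[OF refl refl] B_eq using j(1) by simp
    qed
  qed
  ultimately have "cleared i \<union> (Y - cleared i) \<subseteq> Z" by blast
  then have "sum (weight I) (cleared i \<union> (Y - cleared i)) \<le> sum (weight I) Z"
    using \<open>Z \<subseteq> X\<close> by (intro sum_mono2) (auto intro: finite_subset)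
  \<comment> \<open>The residual ignores cleared points, so the cleared weight and the blue weight
    of \<open>Y\<close> add up without overlap.\<close>
  moreover have "sum (weight I) (cleared i \<union> (Y - cleared i)) =
      sum (weight I) (cleared i) + sum (residual I i) Y"
    using \<open>Y \<subseteq> X\<close> cleared_subset[of i] unfolding sum_residual[OF \<open>Y \<subseteq> X\<close>]
    by (intro sum.union_disjoint) (auto intro: finite_subset)
  ultimately have "demand I \<le> sum (weight I) Z"
    using blue unfolding quota_eq by linarith
  then show "robust_covers I \<B>" unfolding robust_covers_def Z_def .
qed


subsection \<open>Feasibility\<close>

text \<open>While some point has positive residual, the \<open>r\<close>-ball of the pivot has
  positive weight by maximality and lies inside the \<open>3r\<close>-ball being cleared. Each step
  therefore lowers the number of points with positive residual.\<close>

lemma residual_vanishes: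
  assumes "q \<in> X"
  shows "residual I n q = 0"
proof -
  have "card {q \<in> X. 0 < residual I i q} \<le> n - i" for i
  proof (induction i)
    case 0
    show ?case by (simp add: card_mono)
  next
    case (Suc i)
    let ?A = "{q \<in> X. 0 < residual I i q}" and ?B = "{q \<in> X. 0 < residual I (Suc i) q}"
    have sub: "?B \<subseteq> ?A" by (auto simp: residual_Suc split: if_splits)
    show ?case
    proof (cases "?A = {}")
      case True
      then have "?B = {}" using sub by blast
      then show ?thesis by (metis card.empty zero_le)
    next
      case False
      then obtain q where q: "q \<in> X" "0 < residual I i q" by blast
      have "0 < ball_weight I (residual I i) r q"
        unfolding ball_weight_eq by (rule sum_pos2[of _ q]) (use q in auto)
      also have "\<dots> \<le> ball_weight I (residual I i) r (pivot I i)"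
        by (rule pivot_max[OF q(1)])
      finally have "sum (residual I i) {q \<in> X. d (pivot I i) q \<le> r} \<noteq> 0"
        unfolding ball_weight_eq by (rule gr_implies_not0)
      then obtain p where "p \<in> {q \<in> X. d (pivot I i) q \<le> r}" "residual I i p \<noteq> 0"
        by (rule sum.not_neutral_contains_not_neutral)
      then have p: "p \<in> X" "d (pivot I i) p \<le> r" "0 < residual I i p" by auto
      have "d (pivot I i) p \<le> 3 * r" using p(2) r_nonneg by linarith
      then have "p \<in> ?A" "p \<notin> ?B" using p by (auto simp: residual_Suc)
      then have "?B \<subset> ?A" using sub by blast
      then have "card ?B < card ?A" by (intro psubset_card_mono) auto
      with Suc show ?thesis by linarith
    qed
  qed
  from this[of n] have "{q \<in> X. 0 < residual I n q} = {}" by simp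
  with assms show ?thesis by fastforce
qed

text \<open>The \<open>3r\<close>-ball of the pivot may still meet \<open>L\<close> in points with
  no weight left. If step \<open>j\<close> is not untouched, its pivot is within \<open>3r\<close>
  of \<open>L\<close>.\<close>

definition untouched :: "nat set \<Rightarrow> nat \<Rightarrow> nat set" where
  "untouched L i = {j. j < i \<and> (\<forall>q\<in>L. d (pivot I j) q \<le> 3 * r \<longrightarrow> residual I j q = 0)}"

lemma untouched_Suc:
  "untouched L (Suc i) = (if \<forall>q\<in>L. d (pivot I i) q \<le> 3 * r \<longrightarrow> residual I i q = 0
     then insert i (untouched L i) else untouched L i)"
  by (auto simp: untouched_def less_Suc_eq)

lemma finite_untouched [simp]: "finite (untouched L i)"
  by (simp add: untouched_def)

definition small :: "nat \<Rightarrow> nat set" where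
  "small a = {q \<in> X. d a q \<le> r}"

text \<open>\<open>A\<close> is the set of centers of the small balls not yet charged before step \<open>i\<close>.\<close>

definition charged :: "nat set \<Rightarrow> nat set \<Rightarrow> nat \<Rightarrow> nat \<Rightarrow> nat set \<Rightarrow> bool" where
  "charged L A\<^sub>0 w i A \<longleftrightarrow> A \<subseteq> A\<^sub>0 \<and> card A + card (untouched L i) \<le> k \<and>
     w \<le> sum (weight I) (cleared i) + sum (residual I i) (L \<union> \<Union>(small ` A))"

text \<open>A ball is dropped from \<open>A\<close> exactly at untouched steps, which preserves the
  bound by \<open>k\<close>. The weight bound survives if the residual weight lost from the union of
  \<open>L\<close> and the small balls is at most the residual weight of \<open>?K\<close>, since
  that is what the cleared weight gains.\<close>

lemma charged_step:
  assumes "L \<subseteq> X" "A\<^sub>0 \<subseteq> X" and ch: "charged L A\<^sub>0 w i A" and "A \<noteq> {}"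
  shows "\<exists>A'. charged L A\<^sub>0 w (Suc i) A'"
proof -
  let ?u = "residual I i" and ?K = "{q \<in> X. d (pivot I i) q \<le> 3 * r}"
  have A: "A \<subseteq> A\<^sub>0" "card A + card (untouched L i) \<le> k"
    "w \<le> sum (weight I) (cleared i) + sum ?u (L \<union> \<Union>(small ` A))"
    using ch by (auto simp: charged_def)
  have "finite A" using A(1) assms(2) by (meson finite_X finite_subset)
  have sub: "L \<union> \<Union>(small ` A') \<subseteq> X" for A'
    using assms(1) by (auto simp: small_def)
  have fin: "finite B" if "B \<subseteq> X" for B using that by (rule finite_subset) simp
  have next_sum: "sum (residual I (Suc i)) B = sum ?u (B - ?K)" if "B \<subseteq> X" for B
  proof -
    have "sum (residual I (Suc i)) B = (\<Sum>q\<in>B. if q \<in> ?K then 0 else ?u q)"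
      using that by (intro sum.cong) (auto simp: residual_Suc)
    also have "\<dots> = sum ?u (B - ?K)"
      by (rule sum.mono_neutral_cong_right) (use fin[OF that] in auto)
    finally show ?thesis .
  qed
  have split: "sum ?u B = sum ?u (B \<inter> ?K) + sum ?u (B - ?K)" if "B \<subseteq> X" for B
    using fin[OF that] by (rule sum.Int_Diff)
  have suffices: "charged L A\<^sub>0 w (Suc i) A'"
    if "A' \<subseteq> A" "card A' + card (untouched L (Suc i)) \<le> k"
      "sum ?u (L \<union> \<Union>(small ` A)) \<le> sum ?u ?K + sum ?u ((L \<union> \<Union>(small ` A')) - ?K)" for A'
    using that A unfolding charged_def weight_cleared_Suc next_sum[OF sub] by auto
  show ?thesis
  proof (cases "\<forall>q\<in>L. d (pivot I i) q \<le> 3 * r \<longrightarrow> ?u q = 0")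
    case False
    \<comment> \<open>No ball is dropped here, so all the weight that is lost lies in
      \<open>?K\<close>.\<close>
    have "sum ?u ((L \<union> \<Union>(small ` A)) \<inter> ?K) \<le> sum ?u ?K"
      by (rule sum_mono2) auto
    then have "charged L A\<^sub>0 w (Suc i) A"
      using A(2) False split[OF sub] by (intro suffices) (auto simp: untouched_Suc)
    then show ?thesis ..
  next
    case True
    have card_unt: "card (untouched L (Suc i)) = Suc (card (untouched L i))"
      using True by (subst untouched_Suc) (simp add: untouched_def)
    have card_drop: "card (A - {a}) + card (untouched L (Suc i)) \<le> k" if "a \<in> A" for a
    proof -
      have "card A = Suc (card (A - {a}))" using card.remove[OF \<open>finite A\<close> that] .
      then show ?thesis using A(2) card_unt by linarith
    qed
    show ?thesis
    proof (cases "\<exists>a\<in>A. small a \<inter> small (pivot I i) \<noteq> {}")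
      case True
      then obtain a p where a: "a \<in> A" "p \<in> small a" "p \<in> small (pivot I i)" by blast
      have "a \<in> X" using a(1) A(1) assms(2) by blast
      \<comment> \<open>Three distances of at most \<open>r\<close> each: pivot to \<open>p\<close>,
        \<open>p\<close> to \<open>a\<close>, and \<open>a\<close> to \<open>q\<close>. This is why
        clearing uses radius \<open>3r\<close>.\<close>
      have "small a \<subseteq> ?K"
      proof
        fix q assume q: "q \<in> small a"
        have "d (pivot I i) q \<le> d (pivot I i) p + d p a + d a q"
          using triangle[of "pivot I i" p q] triangle[of p a q] a q \<open>a \<in> X\<close>
          by (force simp: small_def)
        moreover have "d p a \<le> r" using a(2) commute[of p a] by (simp add: small_def)
        ultimately show "q \<in> ?K" using a(3) q by (simp add: small_def)
      qed
      \<comment> \<open>Outside \<open>?K\<close>, dropping \<open>a\<close> loses nothing.\<close>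
      then have eq: "(L \<union> \<Union>(small ` A)) - ?K = (L \<union> \<Union>(small ` (A - {a}))) - ?K" by blast
      have "sum ?u ((L \<union> \<Union>(small ` A)) \<inter> ?K) \<le> sum ?u ?K"
        by (rule sum_mono2) auto
      then have "charged L A\<^sub>0 w (Suc i) (A - {a})"
        using card_drop[OF a(1)] split[OF sub[of A]] unfolding eq by (intro suffices) auto
      then show ?thesis ..
    next
      case False
      from \<open>A \<noteq> {}\<close> obtain a where a: "a \<in> A" by blast
      have "a \<in> X" using a A(1) assms(2) by blast
      let ?R = "L \<union> \<Union>(small ` (A - {a}))"
      have "sum ?u (L \<union> \<Union>(small ` A)) \<le> sum ?u (?R \<union> small a)"
        using sub[of "A - {a}"] by (intro sum_mono2) (auto intro!: fin simp: small_def)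
      also have "\<dots> \<le> sum ?u ?R + sum ?u (small a)"
      proof -
        have "finite (small a)" by (rule fin) (auto simp: small_def)
        then show ?thesis using fin[OF sub[of "A - {a}"]] by (simp add: sum_Un_nat)
      qed
      \<comment> \<open>The dropped ball is paid for by the \<open>r\<close>-ball of the pivot,
        which is heaviest.\<close>
      also have "sum ?u (small a) \<le> sum ?u (small (pivot I i))"
        using pivot_max[OF \<open>a \<in> X\<close>] unfolding ball_weight_eq small_def .
      also have "sum ?u ?R = sum ?u (?R \<inter> ?K) + sum ?u (?R - ?K)"
        by (rule split[OF sub])
      \<comment> \<open>The step is untouched, so \<open>L\<close> has no residual weight in
        \<open>?K\<close>.\<close>
      also have "sum ?u (?R \<inter> ?K) = sum ?u (\<Union>(small ` (A - {a})) \<inter> ?K)"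
        using sub[of "A - {a}"] True by (intro sum.mono_neutral_right) (auto intro: fin)
      finally have "sum ?u (L \<union> \<Union>(small ` A)) \<le>
          sum ?u (\<Union>(small ` (A - {a})) \<inter> ?K) + sum ?u (small (pivot I i)) + sum ?u (?R - ?K)"
        by linarith
      \<comment> \<open>No small ball in \<open>A\<close> meets that of the pivot, so these are
        disjoint subsets of \<open>?K\<close>.\<close>
      moreover have "sum ?u (\<Union>(small ` (A - {a})) \<inter> ?K) + sum ?u (small (pivot I i)) \<le> sum ?u ?K"
      proof -
        have "sum ?u (\<Union>(small ` (A - {a})) \<inter> ?K) + sum ?u (small (pivot I i)) =
            sum ?u (\<Union>(small ` (A - {a})) \<inter> ?K \<union> small (pivot I i))"
          using False by (intro sum.union_disjoint[symmetric]) (auto simp: small_def)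
        also have "\<dots> \<le> sum ?u ?K"
          using order_trans[OF _ r_le_3r] by (intro sum_mono2) (auto simp: small_def)
        finally show ?thesis .
      qed
      ultimately have "charged L A\<^sub>0 w (Suc i) (A - {a})"
        using card_drop[OF a] by (intro suffices) auto
      then show ?thesis ..
    qed
  qed
qed

text \<open>\<open>charged_step\<close> is iterated from \<open>A\<^sub>0\<close>. The first index
  at which \<open>A\<close> becomes empty is good; otherwise index \<open>n\<close> is good because
  no residual weight is left there.\<close>

lemma exhausted_level:
  assumes "L \<subseteq> X" "A\<^sub>0 \<subseteq> X" "card A\<^sub>0 \<le> k"
  obtains i where "i \<le> n" "card (untouched L i) \<le> k"
    "sum (weight I) (L \<union> \<Union>(small ` A\<^sub>0)) \<le> sum (weight I) (cleared i) + sum (residual I i) L"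
proof -
  let ?w = "sum (weight I) (L \<union> \<Union>(small ` A\<^sub>0))"
  define good where "good i \<longleftrightarrow> card (untouched L i) \<le> k \<and>
    ?w \<le> sum (weight I) (cleared i) + sum (residual I i) L" for i
  have "\<exists>i\<le>n. good i"
  proof (rule ccontr)
    assume bad: "\<not> ?thesis"
    have "\<exists>A. charged L A\<^sub>0 ?w i A" if "i \<le> n" for i
      using that
    proof (induction i)
      case 0
      have "charged L A\<^sub>0 ?w 0 A\<^sub>0"
        using assms(3) by (simp add: charged_def untouched_def)
      then show ?case ..
    next
      case (Suc i)
      then obtain A where A: "charged L A\<^sub>0 ?w i A" by auto
      have "\<not> good i" using bad Suc.prems by auto
      \<comment> \<open>For empty \<open>A\<close>, \<open>charged\<close> would give both
        conditions of \<open>good\<close>.\<close>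
      with A have "A \<noteq> {}" by (auto simp: charged_def good_def)
      with A show ?case using charged_step assms by blast
    qed
    then obtain A where A: "charged L A\<^sub>0 ?w n A" by blast
    have "sum (residual I n) (L \<union> \<Union>(small ` A)) = 0"
      using assms(1) by (intro sum.neutral) (auto simp: residual_vanishes small_def)
    with A have "good n" by (simp add: charged_def good_def)
    with bad show False by blast
  qed
  with that show thesis unfolding good_def by blast
qed

text \<open>\<open>exhausted_level\<close> is applied to the set \<open>L\<close> covered by the
  balls of the larger radii and the centers \<open>A\<^sub>0\<close> of the smallest ones. Enlarging
  the larger balls by \<open>3r\<close> solves the level it provides.\<close>

lemma feasible_level:
  assumes "robust_feasible I"
  shows "\<exists>i\<le>n. colorful_feasible (level I i)"
proof -
  obtain \<B> where sol: "robust_approx_solution 1 I \<B>"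
    using assms unfolding robust_feasible_def by blast
  have len: "length \<B> = t"
    and fin_B: "\<And>j. j < t \<Longrightarrow> finite (\<B> ! j)"
    and card_B: "\<And>j. j < t \<Longrightarrow> card (\<B> ! j) \<le> budgets I ! j"
    and centres: "\<And>j b. j < t \<Longrightarrow> b \<in> \<B> ! j \<Longrightarrow> fst b \<in> X"
    and rad_B: "\<And>j b. j < t \<Longrightarrow> b \<in> \<B> ! j \<Longrightarrow> snd b = radii I ! j"
    and cov: "demand I \<le> sum (weight I) (covered I \<B>)"
    using sol unfolding robust_approx_solution_def within_budgets_def scaled_radii_def robust_covers_def
    by (auto simp: length_budgets split_beta)
  define L where "L = covered I (butlast \<B>)"
  define A\<^sub>0 where "A\<^sub>0 = fst ` (\<B> ! (t - 1))"
  have "L \<subseteq> X" by (auto simp: L_def mem_covered)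
  have last_t: "t - 1 < t" using t_ge_2 by simp
  have "A\<^sub>0 \<subseteq> X" using centres[OF last_t] by (auto simp: A\<^sub>0_def)
  have "card A\<^sub>0 \<le> k"
    using card_image_le[OF fin_B[OF last_t], of fst] card_B[OF last_t]
    unfolding A\<^sub>0_def last_eq_nth by linarith
  have B_split: "set \<B> = insert (\<B> ! (t - 1)) (set (butlast \<B>))"
  proof -
    have "\<B> \<noteq> []" using len t_ge_2 by auto
    then have "\<B> = butlast \<B> @ [\<B> ! (t - 1)]"
      using len last_conv_nth append_butlast_last_id by metis
    then show ?thesis by (metis list.simps(15) list.set(1) set_append Un_insert_right sup_bot_right)
  qed
  have "covered I \<B> \<subseteq> L \<union> \<Union>(small ` A\<^sub>0)"
  proof
    fix q assume "q \<in> covered I \<B>"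
    then obtain s b where b: "q \<in> X" "s \<in> set \<B>" "b \<in> s" "fst b \<in> X" "d (fst b) q \<le> snd b"
      by (auto simp: mem_covered)
    show "q \<in> L \<union> \<Union>(small ` A\<^sub>0)"
    proof (cases "s \<in> set (butlast \<B>)")
      case True
      then have "q \<in> L" using b unfolding L_def mem_covered[OF refl refl] by blast
      then show ?thesis ..
    next
      case False
      then have s: "s = \<B> ! (t - 1)" using b(2) B_split by auto
      then have "snd b = r" using rad_B[OF last_t] b(3) last_eq_nth by metis
      then have "q \<in> small (fst b)" "fst b \<in> A\<^sub>0" using b s by (auto simp: small_def A\<^sub>0_def)
      then show ?thesis by blast
    qed
  qed
  then have "sum (weight I) (covered I \<B>) \<le> sum (weight I) (L \<union> \<Union>(small ` A\<^sub>0))"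
    using \<open>L \<subseteq> X\<close> by (intro sum_mono2) (auto simp: small_def intro!: finite_subset[OF _ finite_X])
  then have demand: "demand I \<le> sum (weight I) (L \<union> \<Union>(small ` A\<^sub>0))" using cov by linarith
  obtain i where i: "i \<le> n" "card (untouched L i) \<le> k"
    "sum (weight I) (L \<union> \<Union>(small ` A\<^sub>0)) \<le> sum (weight I) (cleared i) + sum (residual I i) L"
    using exhausted_level[OF \<open>L \<subseteq> X\<close> \<open>A\<^sub>0 \<subseteq> X\<close> \<open>card A\<^sub>0 \<le> k\<close>] .
  define grow where "grow = (\<lambda>b :: nat \<times> real. (fst b, snd b + 3 * r))"
  define \<C> where "\<C> = map (image grow) (butlast \<B>)"
  have nth_C: "\<C> ! j = grow ` (\<B> ! j)" if "j < t - 1" for j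
    using that len by (simp add: \<C>_def nth_butlast)
  have len_C: "length \<C> = t - 1" using len by (simp add: \<C>_def)
  define Y where "Y = covered (level I i) \<C>"
  have "Y \<subseteq> X" by (auto simp: Y_def mem_covered)
  \<comment> \<open>In particular the enlarged balls cover the pivot of every step that is not
    untouched.\<close>
  have near_L: "p \<in> Y" if "p \<in> X" "q \<in> L" "d p q \<le> 3 * r" for p q
  proof -
    from \<open>q \<in> L\<close> obtain s b where b: "s \<in> set (butlast \<B>)" "b \<in> s" "fst b \<in> X" "d (fst b) q \<le> snd b" "q \<in> X"
      by (auto simp: L_def mem_covered)
    have "d (fst b) p \<le> snd b + 3 * r"
      using triangle[OF b(3) b(5) \<open>p \<in> X\<close>] b(4) that(3) commute[of p q] by linarith
    then have "\<exists>b'\<in>grow ` s. fst b' \<in> X \<and> d (fst b') p \<le> snd b'"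
      using b(2,3) by (intro bexI[of _ "grow b"]) (simp_all add: grow_def)
    then show ?thesis
      using b(1) \<open>p \<in> X\<close> unfolding Y_def mem_covered[OF level_simps(1,2)] \<C>_def set_map by blast
  qed
  have "L \<subseteq> Y"
  proof
    fix q assume "q \<in> L"
    then show "q \<in> Y" using near_L[of q q] \<open>L \<subseteq> X\<close> by auto
  qed
  have "within_budgets (level I i) \<C>"
    unfolding within_budgets_def
  proof (intro conjI allI impI)
    show "length \<C> = length (budgets (level I i))" using len_C length_budgets by simp
  next
    fix j assume "j < length \<C>"
    then have j: "j < t - 1" "j < t" using len_C by auto
    show "finite (\<C> ! j)" using fin_B j nth_C by simp
    show "card (\<C> ! j) \<le> budgets (level I i) ! j"
      using card_image_le[OF fin_B[OF j(2)], of grow] card_B[OF j(2)] nth_C j length_budgets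
      by (simp add: nth_butlast)
    show "\<forall>(p, \<rho>)\<in>\<C> ! j. p \<in> points (level I i)"
      using centres j nth_C by (auto simp: grow_def)
  qed
  moreover have "scaled_radii 1 (level I i) \<C>"
    unfolding scaled_radii_def
  proof (intro allI impI)
    fix j assume "j < length \<C>"
    then have j: "j < t - 1" "j < t" using len_C by auto
    show "\<forall>(p, \<rho>)\<in>\<C> ! j. \<rho> = 1 * radii (level I i) ! j"
      using rad_B j nth_C length_radii by (auto simp: grow_def nth_butlast)
  qed
  moreover have "colorful_covers (level I i) \<C>"
  proof -
    \<comment> \<open>At most \<open>k\<close> of the \<open>i\<close> steps are untouched, so at
      least \<open>i - k\<close> steps have their pivot in \<open>Y\<close>.\<close>
    have "{..<i} - untouched L i \<subseteq> {j. j < i \<and> pivot I j \<in> Y}"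
      using near_L by (auto simp: untouched_def)
    then have "card ({..<i} - untouched L i) \<le> card {j. j < i \<and> pivot I j \<in> Y}"
      by (intro card_mono) auto
    moreover have "card {..<i} - card (untouched L i) \<le> card ({..<i} - untouched L i)"
      by (rule diff_card_le_card_Diff) simp
    ultimately have "i - k \<le> sum (marks I i) Y"
      using i(2) unfolding sum_marks[OF \<open>Y \<subseteq> X\<close>] card_lessThan by linarith
    \<comment> \<open>The weight bound for level \<open>i\<close> leaves at least the quota as
      residual weight of \<open>L\<close>, which lies inside \<open>Y\<close>.\<close>
    moreover have "sum (residual I i) L \<le> sum (residual I i) Y"
      using \<open>L \<subseteq> Y\<close> \<open>Y \<subseteq> X\<close> by (intro sum_mono2) (auto intro: finite_subset[OF _ finite_X])
    then have "quota I i \<le> sum (residual I i) Y"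
      using i(3) demand unfolding quota_eq by linarith
    ultimately show ?thesis unfolding colorful_covers_def Y_def by simp
  qed
  ultimately have "colorful_approx_solution 1 (level I i) \<C>"
    unfolding colorful_approx_solution_def by blast
  then show ?thesis using i(1) unfolding colorful_feasible_def by blast
qed

end

section \<open>Assembly of the reduction and the lifting\<close>

theorem theorem2:
  fixes \<I> :: "nat robust_nukc set"
  defines "\<I> \<equiv> {I. numbered I \<and> (\<exists>t\<ge>2. robust_instance t I)}"
  shows "\<exists>(reduce :: nat robust_nukc \<Rightarrow> nat colorful_nukc list)
          (lift :: nat robust_nukc \<times> nat colorful_nukc \<times> (nat \<times> real) list list
                     \<Rightarrow> (nat \<times> real) list list).
     poly_time_computable \<I> enc_robust (enc_list enc_colorful) reduce \<and>
     (\<exists>C. \<forall>I\<in>\<I>. length (reduce I) \<le> C * card (points I)) \<and>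
     (\<forall>I\<in>\<I>. \<forall>t. robust_instance t I \<longrightarrow>
        (\<forall>J\<in>set (reduce I).
           colorful_instance (t - 1) J \<and>
           points J = points I \<and> metric_fn J = metric_fn I \<and>
           budgets J = take (t - 1) (budgets I) \<and>
           (\<forall>i<t - 1. radii J ! i = radii I ! i + 3 * radii I ! (t - 1))) \<and>
        (robust_feasible I \<longrightarrow> (\<exists>J\<in>set (reduce I). colorful_feasible J))) \<and>
     poly_time_computable
       {(I, J, S). I \<in> \<I> \<and> J \<in> set (reduce I) \<and>
          (\<exists>\<alpha>\<ge>0. colorful_approx_solution \<alpha> J (map set S))}
       enc_triple enc_balls lift \<and>
     (\<forall>I\<in>\<I>. \<forall>t. robust_instance t I \<longrightarrow>
        (\<forall>J\<in>set (reduce I). \<forall>\<alpha>\<ge>0. \<forall>S. colorful_approx_solution \<alpha> J (map set S) \<longrightarrow>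
           (let \<B> = map set (lift (I, J, S)) in
              within_budgets I \<B> \<and>
              (\<forall>i<t. \<forall>(p, \<rho>)\<in>\<B> ! i.
                 0 \<le> \<rho> \<and> \<rho> \<le> \<alpha> * radii I ! i + (3 * \<alpha> + 3) * radii I ! (t - 1)) \<and>
              robust_covers I \<B>)))"
proof -
  \<comment> \<open>The number of radii is determined by the instance, so the \<open>t'\<close> from
    membership is the given \<open>t\<close>.\<close>
  have inst: "robust_nukc_instance I t" if "I \<in> \<I>" "robust_instance t I" for I t
  proof -
    from that(1) obtain t' where "numbered I" "2 \<le> t'" "robust_instance t' I"
      by (auto simp: \<I>_def)
    moreover from this that(2) have "t' = t"
      unfolding robust_instance_def nukc_frame_def by metis
    ultimately show ?thesis by (simp add: robust_nukc_instance_def)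
  qed
  have ex_inst: "\<exists>t. robust_nukc_instance I t" if "I \<in> \<I>" for I
    using that inst by (auto simp: \<I>_def)
  show ?thesis
  proof (intro exI[of _ levels] exI[of _ lift_balls] conjI)
    show "poly_time_computable \<I> enc_robust (enc_list enc_colorful) levels"
    proof (rule poly_time_computableI)
      fix I assume "I \<in> \<I>"
      then obtain t where "robust_nukc_instance I t" using ex_inst by blast
      then interpret robust_nukc_instance I t .
      show "runs_in (prog main_reduce) 0 [enc_robust I] (enc_list enc_colorful (levels I))
          (500 * (val_size (enc_robust I) + 1) ^ 3)"
        using n_pos budgets_nonempty radii_nonempty by (rule runs_reduce)
    qed (simp add: prog_def)
  next
    \<comment> \<open>There are \<open>n + 1\<close> levels, and \<open>n\<close> is
      positive.\<close>
    have "length (levels I) \<le> 2 * card (points I)" if I: "I \<in> \<I>" for I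
    proof -
      obtain t where "robust_nukc_instance I t" using ex_inst[OF I] by blast
      then interpret robust_nukc_instance I t .
      show ?thesis using n_pos by (simp add: levels_def)
    qed
    then show "\<exists>C. \<forall>I\<in>\<I>. length (levels I) \<le> C * card (points I)" by blast
  next
    show "\<forall>I\<in>\<I>. \<forall>t. robust_instance t I \<longrightarrow>
        (\<forall>J\<in>set (levels I).
           colorful_instance (t - 1) J \<and>
           points J = points I \<and> metric_fn J = metric_fn I \<and>
           budgets J = take (t - 1) (budgets I) \<and>
           (\<forall>i<t - 1. radii J ! i = radii I ! i + 3 * radii I ! (t - 1))) \<and>
        (robust_feasible I \<longrightarrow> (\<exists>J\<in>set (levels I). colorful_feasible J))"
    proof (intro ballI allI impI)
      fix I t assume "I \<in> \<I>" "robust_instance t I"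
      then interpret robust_nukc_instance I t by (rule inst)
      have "robust_feasible I \<longrightarrow> (\<exists>J\<in>set (levels I). colorful_feasible J)"
        using feasible_level by (fastforce simp: levels_def simp del: upt_Suc)
      moreover have "colorful_instance (t - 1) J \<and>
           points J = points I \<and> metric_fn J = metric_fn I \<and>
           budgets J = take (t - 1) (budgets I) \<and>
           (\<forall>i<t - 1. radii J ! i = radii I ! i + 3 * radii I ! (t - 1))" if "J \<in> set (levels I)" for J
      proof -
        from that obtain i where "J = level I i" by (auto simp: levels_def)
        then show ?thesis
          using colorful_instance_level unfolding last_eq_nth
          by (simp add: butlast_conv_take length_budgets length_radii)
      qed
      ultimately show "(\<forall>J\<in>set (levels I).
           colorful_instance (t - 1) J \<and>
           points J = points I \<and> metric_fn J = metric_fn I \<and>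
           budgets J = take (t - 1) (budgets I) \<and>
           (\<forall>i<t - 1. radii J ! i = radii I ! i + 3 * radii I ! (t - 1))) \<and>
        (robust_feasible I \<longrightarrow> (\<exists>J\<in>set (levels I). colorful_feasible J))" by blast
    qed
  next
    show "poly_time_computable
       {(I, J, S). I \<in> \<I> \<and> J \<in> set (levels I) \<and>
          (\<exists>\<alpha>\<ge>0. colorful_approx_solution \<alpha> J (map set S))}
       enc_triple enc_balls lift_balls"
    proof (rule poly_time_computableI)
      fix z assume "z \<in> {(I, J, S). I \<in> \<I> \<and> J \<in> set (levels I) \<and>
          (\<exists>\<alpha>\<ge>0. colorful_approx_solution \<alpha> J (map set S))}"
      then obtain I J S \<alpha> where z: "z = (I, J, S)" and I: "I \<in> \<I>" and J: "J \<in> set (levels I)"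
        and sol: "colorful_approx_solution \<alpha> J (map set S)" by blast
      obtain t where "robust_nukc_instance I t" using ex_inst[OF I] by blast
      then interpret robust_nukc_instance I t .
      from J obtain i where J': "J = level I i" by (auto simp: levels_def)
      \<comment> \<open>The centers must be valid indices, as the lookup of distances would get
        stuck otherwise.\<close>
      have "\<forall>bs\<in>set S. \<forall>b\<in>set bs. fst b < card (points I)"
      proof (intro ballI)
        fix bs b assume "bs \<in> set S" "b \<in> set bs"
        then obtain j where "j < length S" "b \<in> set (S ! j)" by (metis in_set_conv_nth)
        then have "fst b \<in> points I"
          using sol unfolding J' colorful_approx_solution_def within_budgets_def by fastforce
        then show "fst b < card (points I)" by (simp add: mem_X)
      qed
      then show "runs_in (prog main_lift) 0 [enc_triple z] (enc_balls (lift_balls z))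
          (500 * (val_size (enc_triple z) + 1) ^ 3)"
        unfolding z using radii_nonempty by (rule runs_lift) (simp add: J')
    qed (simp add: prog_def)
  next
    show "\<forall>I\<in>\<I>. \<forall>t. robust_instance t I \<longrightarrow>
        (\<forall>J\<in>set (levels I). \<forall>\<alpha>\<ge>0. \<forall>S. colorful_approx_solution \<alpha> J (map set S) \<longrightarrow>
           (let \<B> = map set (lift_balls (I, J, S)) in
              within_budgets I \<B> \<and>
              (\<forall>i<t. \<forall>(p, \<rho>)\<in>\<B> ! i.
                 0 \<le> \<rho> \<and> \<rho> \<le> \<alpha> * radii I ! i + (3 * \<alpha> + 3) * radii I ! (t - 1)) \<and>
              robust_covers I \<B>))"
    proof (intro ballI allI impI)
      fix I t J \<alpha> S
      assume "I \<in> \<I>" "robust_instance t I" and J: "J \<in> set (levels I)" and \<alpha>: "0 \<le> (\<alpha> :: real)"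
        and sol: "colorful_approx_solution \<alpha> J (map set S)"
      then interpret robust_nukc_instance I t by (intro inst)
      from J obtain i where J': "J = level I i" by (auto simp: levels_def)
      show "let \<B> = map set (lift_balls (I, J, S)) in
              within_budgets I \<B> \<and>
              (\<forall>i<t. \<forall>(p, \<rho>)\<in>\<B> ! i.
                 0 \<le> \<rho> \<and> \<rho> \<le> \<alpha> * radii I ! i + (3 * \<alpha> + 3) * radii I ! (t - 1)) \<and>
              robust_covers I \<B>"
        unfolding Let_def last_eq_nth J'
        using lift_solution[OF \<alpha> sol[unfolded J']] by blast
    qed
  qed
qed

end
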